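(* Let $p>11$ be prime, $q=p^h$, $n>3$. The Fermat curve $\mathcal{F}: X^n+Y^n=Z^n$ is nonclassical with respect to $\Sigma_3$ if and only if $p$ divides $(n-2)(n-1)(n+1)(2n-1)(n-3)(3n-1)$.
   Context: $\Sigma_3$ is the linear system of plane cubics. The function field of $\mathcal{F}$ is $\overline{\mathbb{F}}_q(x,y)$ with $x^n+y^n=1$. The order sequence $(\varepsilon_0,\dots,\varepsilon_9)$ of $\mathcal{F}$ with respect to $\Sigma_3$ is the lexicographically minimal increasing sequence of nonnegative integers with $\det(D_t^{(\varepsilon_k)}(x^iy^j))_{0\le k\le 9,\,0\le i+j\le3}\neq0$ ($t$ a separating variable, $D_t^{(r)}$ Hasse derivatives); equivalently, the common sequence, for all but finitely many $P\in\mathcal{F}$, of the 10 distinct values $I(P,\mathcal{F}\cap\mathcal{C})$ for cubics $\mathcal{C}$. $\mathcal{F}$ is classical with respect to $\Sigma_3$ if $\varepsilon_i=i$ for all $i$, nonclassical otherwise. *)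

theory Defs
  imports "HOL-Computational_Algebra.Polynomial"
          "HOL-Computational_Algebra.Formal_Power_Series"
          "Jordan_Normal_Form.Determinant"
begin

definition transcendental_over_prime :: "nat \<Rightarrow> 'a::field \<Rightarrow> bool" where
  "transcendental_over_prime p x \<longleftrightarrow>
     (\<forall>P :: int poly. poly (map_poly of_int P) x = 0 \<longrightarrow> (\<forall>i. int p dvd coeff P i))"

(* The Taylor expansion of y in the variable x: the unique power series Y(T) with
   Y(0) = y and (x+T)^n + Y(T)^n = 1.  The map f \<mapsto> \<Sum>_r D_x^(r)(f) T^r is the
   ring homomorphism with x \<mapsto> x + T (Hasse-Schmidt), hence it sends y to Y. *)
definition fermat_taylor_y :: "nat \<Rightarrow> 'a::field \<Rightarrow> 'a \<Rightarrow> 'a fps" where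
  "fermat_taylor_y n x y =
     (THE Y. fps_nth Y 0 = y \<and> (fps_const x + fps_X) ^ n + Y ^ n = 1)"

definition hasse_mono :: "nat \<Rightarrow> 'a::field \<Rightarrow> 'a \<Rightarrow> nat \<Rightarrow> nat \<times> nat \<Rightarrow> 'a" where
  "hasse_mono n x y r ij =
     fps_nth ((fps_const x + fps_X) ^ fst ij * fermat_taylor_y n x y ^ snd ij) r"

definition cubic_monos :: "(nat \<times> nat) list" where
  "cubic_monos = [(0,0),(1,0),(0,1),(2,0),(1,1),(0,2),(3,0),(2,1),(1,2),(0,3)]"

definition cubic_wronskian :: "nat \<Rightarrow> 'a::field \<Rightarrow> 'a \<Rightarrow> nat list \<Rightarrow> 'a" where
  "cubic_wronskian n x y eps =
     det (mat 10 10 (\<lambda>(k, c). hasse_mono n x y (eps ! k) (cubic_monos ! c)))"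

definition admissible_seq :: "nat \<Rightarrow> 'a::field \<Rightarrow> 'a \<Rightarrow> nat list \<Rightarrow> bool" where
  "admissible_seq n x y eps \<longleftrightarrow>
     length eps = 10 \<and> sorted_wrt (<) eps \<and> cubic_wronskian n x y eps \<noteq> 0"

definition order_sequence_cubics :: "nat \<Rightarrow> 'a::field \<Rightarrow> 'a \<Rightarrow> nat list" where
  "order_sequence_cubics n x y =
     (THE eps. admissible_seq n x y eps \<and>
        (\<forall>eps'. admissible_seq n x y eps' \<longrightarrow>
           eps = eps' \<or> (\<exists>k<10. take k eps = take k eps' \<and> eps ! k < eps' ! k)))"

definition classical_cubics :: "nat \<Rightarrow> 'a::field \<Rightarrow> 'a \<Rightarrow> bool" where
  "classical_cubics n x y \<longleftrightarrow> order_sequence_cubics n x y = [0..<10]"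

end

theory Submission
  imports Defs "HOL-Computational_Algebra.Polynomial_FPS"
begin

text \<open>Put \<open>u = x\<^sup>n\<close> and let \<open>\<delta>\<close> be the derivation with \<open>\<delta> x = (1 - u) x\<close> and \<open>\<delta> y = - u y\<close>, so that
  \<open>\<delta> u = n u (1 - u)\<close>. Then \<open>\<delta>\<^sup>k (x\<^sup>i y\<^sup>j) = P\<^sub>k(u) x\<^sup>i y\<^sup>j\<close> for integer polynomials \<open>P\<^sub>k\<close>, and a vanishing
  Wronskian makes the \<open>10 \<times> 10\<close> matrix of these polynomials singular modulo \<open>p\<close>, since \<open>u\<close> is
  transcendental. A vector in its left kernel is a differential operator \<open>\<Sum> a\<^sub>k \<delta>\<^sup>k\<close> of order at most 9,
  with coefficients in the power series in \<open>u\<close> that are not all divisible by \<open>u\<close>, which annihilates all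
  \<open>x\<^sup>i y\<^sup>j\<close> with \<open>i + j \<le> 3\<close>. The exponents of its solutions at \<open>u = 0\<close> (multiplied by \<open>n\<close>) are roots of
  its indicial polynomial, which has degree at most 9. As \<open>1 - y\<close> vanishes to order one in \<open>u\<close>, the
  solutions \<open>x\<^sup>i (1 - y)\<^sup>m\<close> have the exponents \<open>i + m n\<close>; these are ten distinct residues unless \<open>n\<close> is
  congruent to one of \<open>1, 2, 3, -1, 1/2, 1/3\<close> (the stated divisibilities) or \<open>-2, 3/2, -1/2, 2/3\<close>. In the
  last four cases exactly two exponents coincide, and a suitable combination of solutions has a new
  tenth exponent; their distinctness uses \<open>p > 11\<close>.

  In the six exceptional cases \<open>x\<^sup>n + y\<^sup>n = 1\<close> yields a cubic relation between \<open>x\<close> and \<open>y\<close> whose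
  coefficients are \<open>p\<close>-th powers, hence constant to order \<open>p\<close>, so the Wronskian vanishes. That some
  order sequence exists at all follows from the independence of the ten monomials, by an
  Eisenstein-type argument at the simple zero \<open>1\<close> of \<open>1 - X\<^sup>n\<close>.\<close>

no_notation vec_index (infixl "$" 100)
unbundle fps_syntax


section \<open>Roots of power series and the Taylor expansion of y\<close>

lemma fps_root_unique:
  fixes Y Z :: "'a::field fps"
  assumes "of_nat n \<noteq> (0::'a)" "Y $ 0 \<noteq> 0" "Y $ 0 = Z $ 0" "Y ^ n = Z ^ n"
  shows "Y = Z"
proof -
  have "n > 0" using assms(1) by (cases n) auto
  let ?S = "\<Sum>i<n. Y ^ i * Z ^ (n - 1 - i)"
  have "Y ^ n - Z ^ n = (Y - Z) * ?S"
    using diff_power_eq_sum[of Y "n - 1" Z] \<open>n > 0\<close> by simp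
  hence "(Y - Z) * ?S = 0" using assms(4) by simp
  \<comment> \<open>This constant term is nonzero, so \<open>?S\<close> is nonzero and can be
    cancelled in the integral domain of power series.\<close>
  moreover have "?S $ 0 = of_nat n * (Y $ 0) ^ (n - 1)"
  proof -
    have "?S $ 0 = (\<Sum>i<n. (Y $ 0) ^ (n - 1))"
      unfolding fps_sum_nth
      by (intro sum.cong refl) (simp add: fps_power_zeroth assms(3) flip: power_add)
    thus ?thesis by simp
  qed
  hence "?S \<noteq> 0" using assms(1,2) by (metis fps_zero_nth mult_eq_0_iff power_not_zero)
  ultimately show ?thesis by simp
qed

text \<open>The n-th power map has nonzero derivative at \<open>y\<close>, so its translate
  \<open>f\<close> to the origin has a compositional inverse. Composing that inverse with the
  translated \<open>h\<close> gives the root.\<close>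

lemma fps_root_exists:
  fixes h :: "'a::field fps"
  assumes n: "of_nat n \<noteq> (0::'a)" and "y \<noteq> 0" "y ^ n = h $ 0"
  shows "\<exists>Y. Y $ 0 = y \<and> Y ^ n = h"
proof -
  define f where "f = (fps_const y + fps_X) ^ n - fps_const (y ^ n)"
  have f0: "f $ 0 = 0" by (simp add: f_def fps_power_zeroth)
  have "fps_deriv f $ 0 = of_nat n * y ^ (n - 1)"
    by (simp add: f_def fps_deriv_power fps_power_zeroth)
  hence f1: "f $ 1 \<noteq> 0" using assms by simp
  define Z where "Z = fps_inv f oo (h - fps_const (y ^ n))"
  have Z0: "Z $ 0 = 0" by (simp add: Z_def fps_inv_def)
  have h0: "(h - fps_const (y ^ n)) $ 0 = 0" using assms by simp
  have "f oo Z = h - fps_const (y ^ n)"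
    unfolding Z_def using f0 f1 h0
    by (subst fps_compose_assoc) (simp_all add: fps_inv_right, simp add: fps_inv_def)
  moreover have "f oo Z = (fps_const y + Z) ^ n - fps_const (y ^ n)"
    using Z0 by (simp add: f_def fps_compose_sub_distrib fps_compose_power[OF Z0, symmetric]
        fps_compose_add_distrib)
  ultimately have "(fps_const y + Z) ^ n = h" by simp
  thus ?thesis using Z0 by (intro exI[of _ "fps_const y + Z"]) simp
qed

text \<open>Existence and uniqueness of n-th roots make the definite description behind the
  expansion meaningful.\<close>

lemma fermat_taylor_y:
  fixes x y :: "'a::field"
  assumes "of_nat n \<noteq> (0::'a)" "y \<noteq> 0" "x ^ n + y ^ n = 1"
  shows "fermat_taylor_y n x y $ 0 = y"
    and "(fps_const x + fps_X) ^ n + fermat_taylor_y n x y ^ n = 1"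
proof -
  let ?P = "\<lambda>Y. Y $ 0 = y \<and> (fps_const x + fps_X) ^ n + Y ^ n = 1"
  have "y ^ n = (1 - (fps_const x + fps_X) ^ n) $ 0"
    using assms(3) by (simp add: fps_power_zeroth algebra_simps)
  from fps_root_exists[OF assms(1,2) this] obtain Y where "?P Y" by (auto simp: algebra_simps)
  moreover have "Z = Y" if "?P Z" for Z
  proof (rule fps_root_unique[of n])
    show "Z ^ n = Y ^ n"
      using \<open>?P Y\<close> that by (metis add_left_imp_eq)
  qed (use \<open>?P Y\<close> that assms in auto)
  ultimately have "?P (THE Y. ?P Y)" by (rule theI)
  thus "fermat_taylor_y n x y $ 0 = y"
    and "(fps_const x + fps_X) ^ n + fermat_taylor_y n x y ^ n = 1"
    by (auto simp: fermat_taylor_y_def)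
qed

section \<open>The Wronskian as an integer polynomial in \<open>x\<^sup>n\<close>\<close>

text \<open>The target ring varies: the field for values at \<open>x ^ n\<close>, power series for
  Taylor expansions and for the formal variable u.\<close>

definition int_eval :: "'b::comm_ring_1 \<Rightarrow> int poly \<Rightarrow> 'b" where
  "int_eval u P = poly (map_poly of_int P) u"

lemma int_eval_pCons: "int_eval u (pCons a P) = of_int a + u * int_eval u P"
  by (simp add: int_eval_def map_poly_pCons)

lemma int_eval_0 [simp]: "int_eval u 0 = 0"
  by (simp add: int_eval_def)

lemma int_eval_1 [simp]: "int_eval u 1 = 1"
  by (simp add: int_eval_def)

lemma int_eval_smult: "int_eval u (smult a P) = of_int a * int_eval u P"
  by (induction P) (simp_all add: int_eval_pCons algebra_simps)

lemma int_eval_add: "int_eval u (P + Q) = int_eval u P + int_eval u Q"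
  by (induction P Q rule: poly_induct2) (simp_all add: int_eval_pCons algebra_simps)

lemma int_eval_minus: "int_eval u (- P) = - int_eval u P"
  using int_eval_add[of u P "- P"] by (simp add: eq_neg_iff_add_eq_0 add.commute)

lemma int_eval_mult: "int_eval u (P * Q) = int_eval u P * int_eval u Q"
  by (induction P) (simp_all add: int_eval_pCons int_eval_add int_eval_smult algebra_simps)

lemma int_eval_monom: "int_eval u (monom a k) = of_int a * u ^ k"
  by (induction k) (simp_all add: monom_Suc monom_0 int_eval_pCons)

lemma int_eval_sum: "int_eval u (sum f A) = (\<Sum>i\<in>A. int_eval u (f i))"
  by (induction A rule: infinite_finite_induct) (simp_all add: int_eval_add)

lemma comm_ring_hom_int_eval: "comm_ring_hom (int_eval u)"
  by unfold_locales (simp_all add: int_eval_add int_eval_mult)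

lemma fps_int_eval_nth_0: "int_eval U P $ 0 = int_eval (U $ 0) P"
  by (induction P) (auto simp: int_eval_pCons fps_of_int[symmetric])

lemma fps_deriv_int_eval: "fps_deriv (int_eval U P) = int_eval U (pderiv P) * fps_deriv U"
  by (induction P)
     (auto simp: int_eval_pCons pderiv_pCons int_eval_add algebra_simps fps_of_int[symmetric])

text \<open>The derivation \<open>c * fps_deriv f\<close> conjugated by a formal factor g with c g'
  / g = w. The factor itself, for instance a fractional power of u, need not be a power series. For
  \<open>w = 0\<close> this is the derivation.\<close>

definition twist :: "'a::field fps \<Rightarrow> 'a fps \<Rightarrow> 'a fps \<Rightarrow> 'a fps" where
  "twist w c f = w * f + c * fps_deriv f"

text \<open>These are the polynomials P of the overview. The recursion is the product rule for
  \<delta> on P(u) times a monomial: \<delta> u = n u (1 - u), and the monomial contributes the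
  factor i (1 - u) - j u.\<close>

primrec wron_poly :: "nat \<Rightarrow> nat \<Rightarrow> nat \<Rightarrow> nat \<Rightarrow> int poly" where
  "wron_poly n i j 0 = 1"
| "wron_poly n i j (Suc k) =
     [:0, int n, - int n:] * pderiv (wron_poly n i j k)
     + [:int i, - int i - int j:] * wron_poly n i j k"

text \<open>General \<open>w\<close> and \<open>c\<close> allow two uses: on Taylor expansions, with
  \<open>w = 0\<close> and \<open>U = X ^ n\<close>, and at u = 0, with
  \<open>U = fps_X\<close>.\<close>

lemma twist_power_eq_wron_poly:
  assumes U: "c * fps_deriv U = of_nat n * U * (1 - U)"
    and B: "twist w c B = (of_nat i * (1 - U) - of_nat j * U) * B"
  shows "(twist w c ^^ k) B = int_eval U (wron_poly n i j k) * B"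
proof (induction k)
  case (Suc k)
  let ?Q = "int_eval U (wron_poly n i j k)" and ?Q' = "int_eval U (pderiv (wron_poly n i j k))"
  have "(twist w c ^^ Suc k) B = w * (?Q * B) + c * (?Q * fps_deriv B + ?Q' * fps_deriv U * B)"
    unfolding funpow.simps o_apply Suc
    by (subst twist_def) (simp add: fps_deriv_int_eval)
  also have "\<dots> = ?Q * twist w c B + ?Q' * (c * fps_deriv U) * B"
    by (simp add: twist_def algebra_simps)
  also have "\<dots> = int_eval U (wron_poly n i j (Suc k)) * B"
    unfolding U B
    by (simp add: int_eval_pCons int_eval_add int_eval_mult int_eval_smult int_eval_minus
        algebra_simps)
  finally show ?case .
qed simp

text \<open>Each application of \<open>twist\<close> lowers the order of vanishing by at most
  one.\<close>

lemma twist_power_nth_eq_0: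
  assumes "\<And>r. r < m \<Longrightarrow> f $ r = 0" and "r + k < m"
  shows "(twist w c ^^ k) f $ r = 0"
  using assms(2)
proof (induction k arbitrary: r)
  case (Suc k)
  have "(w * (twist w c ^^ k) f) $ r = 0"
    unfolding fps_mult_nth using Suc by (intro sum.neutral) auto
  moreover have "(c * fps_deriv ((twist w c ^^ k) f)) $ r = 0"
    unfolding fps_mult_nth using Suc by (intro sum.neutral) auto
  ultimately show ?case
    unfolding funpow.simps o_apply by (subst twist_def) simp
qed (use assms in auto)

lemma twist_add: "twist w c (f + g) = twist w c f + twist w c g"
  by (simp add: twist_def algebra_simps)

lemma twist_const: "twist w c (fps_const a * f) = fps_const a * twist w c f"
  by (simp add: twist_def algebra_simps)

lemma twist_zero: "twist w c 0 = 0"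
  by (simp add: twist_def)

lemma twist_power_add: "(twist w c ^^ k) (f + g) = (twist w c ^^ k) f + (twist w c ^^ k) g"
  by (induction k) (simp_all add: twist_add)

lemma twist_power_const: "(twist w c ^^ k) (fps_const a * f) = fps_const a * (twist w c ^^ k) f"
  by (induction k) (simp_all add: twist_const)

lemma twist_power_zero: "(twist w c ^^ k) 0 = 0"
  by (induction k) (simp_all add: twist_zero)

lemma twist_power_sum:
  "(twist w c ^^ k) (\<Sum>i\<in>A. g i) = (\<Sum>i\<in>A. (twist w c ^^ k) (g i))"
  by (induction A rule: infinite_finite_induct) (simp_all add: twist_power_zero twist_power_add)

section \<open>The matrix of the polynomials and kernel vectors of singular matrices\<close>

definition mono_exp :: "nat \<Rightarrow> nat \<times> nat" where "mono_exp c = cubic_monos ! c"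

definition wron_mat :: "nat \<Rightarrow> int poly mat" where
  "wron_mat n = mat 10 10 (\<lambda>(k, c). wron_poly n (fst (mono_exp c)) (snd (mono_exp c)) k)"

lemma det_eq_0_kernel:
  fixes M :: "nat \<Rightarrow> nat \<Rightarrow> 'b::idom"
  assumes "det (mat n n (\<lambda>(i, j). M i j)) = 0"
  obtains v where "\<exists>j<n. v j \<noteq> 0" "\<And>i. i < n \<Longrightarrow> (\<Sum>j<n. M i j * v j) = 0"
proof -
  let ?M = "mat n n (\<lambda>(i, j). M i j)"
  have "?M \<in> carrier_mat n n" by simp
  from det_0_iff_vec_prod_zero[OF this] assms obtain v
    where v: "v \<in> carrier_vec n" "v \<noteq> 0\<^sub>v n" "?M *\<^sub>v v = 0\<^sub>v n" by auto
  show thesis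
  proof (rule that[of "vec_index v"])
    show "\<exists>j<n. vec_index v j \<noteq> 0"
    proof (rule ccontr)
      assume "\<not> ?thesis"
      hence "v = 0\<^sub>v n" using v(1) by (intro eq_vecI) auto
      thus False using v(2) by simp
    qed
    fix i assume "i < n"
    have "vec_index (?M *\<^sub>v v) i = (\<Sum>j<n. M i j * vec_index v j)"
      using \<open>i < n\<close> v(1) by (simp add: scalar_prod_def atLeast0LessThan)
    thus "(\<Sum>j<n. M i j * vec_index v j) = 0" using v(3) \<open>i < n\<close> by simp
  qed
qed

lemma det_eq_0I:
  fixes M :: "nat \<Rightarrow> nat \<Rightarrow> 'b::idom"
  assumes "\<exists>j<n. v j \<noteq> 0" "\<And>i. i < n \<Longrightarrow> (\<Sum>j<n. M i j * v j) = 0"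
  shows "det (mat n n (\<lambda>(i, j). M i j)) = 0"
proof -
  let ?M = "mat n n (\<lambda>(i, j). M i j)"
  have M: "?M \<in> carrier_mat n n" by simp
  have "?M *\<^sub>v vec n v = 0\<^sub>v n"
    using assms(2) by (intro eq_vecI) (auto simp: scalar_prod_def atLeast0LessThan)
  moreover have "vec n v \<noteq> 0\<^sub>v n"
  proof
    assume "vec n v = 0\<^sub>v n"
    hence "vec_index (vec n v) j = 0" if "j < n" for j using that by simp
    thus False using assms(1) by auto
  qed
  ultimately show ?thesis unfolding det_0_iff_vec_prod_zero[OF M]
    by (intro exI[of _ "vec n v"]) simp
qed

lemma det_eq_0_left_kernel:
  fixes M :: "nat \<Rightarrow> nat \<Rightarrow> 'b::idom"
  assumes "det (mat n n (\<lambda>(i, j). M i j)) = 0"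
  obtains v where "\<exists>i<n. v i \<noteq> 0" "\<And>j. j < n \<Longrightarrow> (\<Sum>i<n. v i * M i j) = 0"
proof -
  have "mat n n (\<lambda>(i, j). M j i) = (mat n n (\<lambda>(i, j). M i j))\<^sup>T"
    by (intro eq_matI) auto
  hence "det (mat n n (\<lambda>(i, j). M j i)) = 0"
    using assms det_transpose[of "mat n n (\<lambda>(i, j). M i j)" n] by simp
  then obtain v where "\<exists>i<n. v i \<noteq> 0" "\<And>j. j < n \<Longrightarrow> (\<Sum>i<n. M i j * v i) = 0"
    by (rule det_eq_0_kernel) blast
  thus thesis by (intro that[of v]) (simp_all add: mult.commute)
qed

text \<open>A kernel vector of the Wronskian is a combination of the monomials vanishing to order
  10. Fewer than ten applications of \<delta> leave its constant term zero, and these ten equations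
  are a kernel relation for the matrix evaluated at \<open>x ^ n\<close>.\<close>

lemma fermat_wronskian_eq_0:
  fixes x y :: "'a::field"
  assumes n: "of_nat n \<noteq> (0::'a)" and "x \<noteq> 0" "y \<noteq> 0" and xy: "x ^ n + y ^ n = 1"
    and "cubic_wronskian n x y [0..<10] = 0"
  shows "int_eval (x ^ n) (det (wron_mat n)) = 0"
proof -
  define X where "X = fps_const x + fps_X"
  define Y where "Y = fermat_taylor_y n x y"
  define mono where "mono c = X ^ fst (mono_exp c) * Y ^ snd (mono_exp c)" for c
  note Y = fermat_taylor_y[OF n \<open>y \<noteq> 0\<close> xy, folded Y_def X_def]
  have n0: "n > 0" using n by (cases n) auto
  have "det (mat 10 10 (\<lambda>(k, c). mono c $ k)) = 0"
  proof -
    have "mat 10 10 (\<lambda>(k, c). mono c $ k) =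
        mat 10 10 (\<lambda>(k, c). hasse_mono n x y ([0..<10] ! k) (cubic_monos ! c))"
      by (intro eq_matI) (auto simp: hasse_mono_def mono_def X_def Y_def mono_exp_def)
    thus ?thesis using assms(5) by (simp add: cubic_wronskian_def)
  qed
  from det_eq_0_kernel[OF this] obtain v
    where v: "\<exists>c<10. v c \<noteq> 0" "\<And>k. k < 10 \<Longrightarrow> (\<Sum>c<10. mono c $ k * v c) = 0" by metis
  define f where "f = (\<Sum>c<10. fps_const (v c) * mono c)"
  have f: "f $ k = 0" if "k < 10" for k
    using v(2)[OF that] by (simp add: f_def fps_sum_nth mult.commute)
  \<comment> \<open>With this factor \<open>twist 0 c\<close> is \<delta>, because
    \<open>Y ^ n = 1 - X ^ n\<close>.\<close>
  define c where "c = X * Y ^ n"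
  have Xn: "X ^ n = X * X ^ (n - 1)" and Yn: "Y ^ n = Y * Y ^ (n - 1)"
    using n0 by (simp_all flip: power_Suc)
  have X': "fps_deriv X = 1" by (simp add: X_def)
  have Yn': "Y ^ n = 1 - X ^ n" using Y(2) by (metis add_diff_cancel_left')
  have dY: "Y ^ (n - 1) * fps_deriv Y = - (X ^ (n - 1))"
  proof -
    have "fps_deriv (X ^ n + Y ^ n) = 0" using Y(2) by simp
    hence "of_nat n * (X ^ (n - 1) + Y ^ (n - 1) * fps_deriv Y) = 0"
      by (simp add: fps_deriv_power X' algebra_simps fps_of_nat)
    moreover have "(of_nat n :: 'a fps) \<noteq> 0"
      using n by (simp flip: fps_of_nat)
    ultimately show ?thesis by (simp add: eq_neg_iff_add_eq_0 add.commute)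
  qed
  have cU: "c * fps_deriv (X ^ n) = of_nat n * X ^ n * (1 - X ^ n)"
  proof -
    have "c * fps_deriv (X ^ n) = of_nat n * (X * X ^ (n - 1)) * Y ^ n"
      by (simp add: c_def fps_deriv_power X' fps_of_nat algebra_simps)
    thus ?thesis unfolding Xn[symmetric] Yn' .
  qed
  have cY: "c * fps_deriv Y = - (X ^ n) * Y"
  proof -
    have "c * fps_deriv Y = X * Y * (Y ^ (n - 1) * fps_deriv Y)"
      unfolding c_def Yn by (simp add: algebra_simps)
    thus ?thesis unfolding dY Xn by (simp add: algebra_simps)
  qed
  have cX: "c * fps_deriv X = (1 - X ^ n) * X"
    by (simp add: X' c_def Yn')
  have tw_mult: "twist 0 c (A * B) = (a + b) * (A * B)"
    if "twist 0 c A = a * A" "twist 0 c B = b * B" for a b A B :: "'a fps"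
  proof -
    have "twist 0 c (A * B) = A * twist 0 c B + twist 0 c A * B"
      by (simp add: twist_def algebra_simps)
    thus ?thesis unfolding that by (simp add: algebra_simps)
  qed
  have tw_pow: "twist 0 c (A ^ i) = (of_nat i * a) * A ^ i" if "twist 0 c A = a * A" for a A i
  proof (induction i)
    case 0
    thus ?case by (simp add: twist_def)
  next
    case (Suc i)
    from tw_mult[OF that this] show ?case by (simp add: algebra_simps)
  qed
  have tw: "twist 0 c (X ^ i * Y ^ j) = (of_nat i * (1 - X ^ n) - of_nat j * X ^ n) * (X ^ i * Y ^ j)"
    for i j
  proof -
    have "twist 0 c X = (1 - X ^ n) * X" "twist 0 c Y = - (X ^ n) * Y"
      using cX cY by (simp_all add: twist_def)
    from tw_mult[OF tw_pow[OF this(1)] tw_pow[OF this(2)]] show ?thesis by simp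
  qed
  define P where "P k d = int_eval (x ^ n) (wron_poly n (fst (mono_exp d)) (snd (mono_exp d)) k)"
    for k d
  \<comment> \<open>Constant terms of the iterates of \<delta> on \<open>f\<close>. The values of
    the monomials are absorbed into the kernel vector, which stays nonzero because x and y are
    nonzero.\<close>
  have rel: "(\<Sum>d<10. P k d * (v d * (x ^ fst (mono_exp d) * y ^ snd (mono_exp d)))) = 0"
    if "k < 10" for k
  proof -
    have "0 = (twist 0 c ^^ k) f $ 0"
      using twist_power_nth_eq_0[of 10 f 0 k 0 c] f that by simp
    also have "(twist 0 c ^^ k) f = (\<Sum>d<10. fps_const (v d) * (twist 0 c ^^ k) (mono d))"
      by (simp add: f_def twist_power_sum twist_power_const)
    also have "\<dots> = (\<Sum>d<10. fps_const (v d) *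
        (int_eval (X ^ n) (wron_poly n (fst (mono_exp d)) (snd (mono_exp d)) k) * mono d))"
      unfolding mono_def using twist_power_eq_wron_poly[OF cU tw] by simp
    finally show ?thesis
      by (simp add: fps_sum_nth fps_int_eval_nth_0 P_def mono_def fps_power_zeroth X_def Y
          algebra_simps)
  qed
  have "\<exists>d<10. v d * (x ^ fst (mono_exp d) * y ^ snd (mono_exp d)) \<noteq> 0"
    using v(1) \<open>x \<noteq> 0\<close> \<open>y \<noteq> 0\<close> by auto
  from det_eq_0I[OF this rel] have "det (mat 10 10 (\<lambda>(k, d). P k d)) = 0" by simp
  also have "mat 10 10 (\<lambda>(k, d). P k d) = map_mat (int_eval (x ^ n)) (wron_mat n)"
    by (intro eq_matI) (auto simp: P_def wron_mat_def)
  finally show ?thesis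
    by (simp add: comm_ring_hom.hom_det[OF comm_ring_hom_int_eval])
qed

lemma transcendental_power_int_eval:
  assumes "transcendental_over_prime p x" "n > 0" "int_eval (x ^ n) P = 0"
  shows "int p dvd coeff P i"
proof (cases "i \<le> degree P")
  case True
  \<comment> \<open>This is \<open>P\<close> with the n-th power of the variable substituted;
    distinct coefficients of \<open>P\<close> stay apart because \<open>n > 0\<close>.\<close>
  define Q where "Q = (\<Sum>j\<le>degree P. monom (coeff P j) (n * j))"
  have "poly (map_poly of_int Q) x = int_eval x Q"
    by (simp add: int_eval_def)
  also have "\<dots> = int_eval (x ^ n) (\<Sum>j\<le>degree P. monom (coeff P j) j)"
    by (simp add: Q_def int_eval_sum int_eval_monom power_mult)
  also have "(\<Sum>j\<le>degree P. monom (coeff P j) j) = P"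
    by (rule poly_as_sum_of_monoms)
  finally have "int p dvd coeff Q (n * i)"
    using assms by (auto simp: transcendental_over_prime_def)
  also have "coeff Q (n * i) = (\<Sum>j\<le>degree P. if j = i then coeff P j else 0)"
    using assms(2) by (simp add: Q_def coeff_sum)
  also have "\<dots> = coeff P i" using True by simp
  finally show ?thesis .
qed (simp add: coeff_eq_0)

text \<open>Carries the vanishing determinant from \<open>x ^ n\<close> over to the formal variable
  \<open>fps_X\<close>.\<close>

lemma int_eval_eq_0_if_dvd:
  assumes "\<And>i. int CHAR('b) dvd coeff P i"
  shows "int_eval (u :: 'b::comm_ring_1) P = 0"
proof -
  have "map_poly of_int P = (0 :: 'b poly)"
    using assms by (intro poly_eqI) (simp add: coeff_map_poly of_int_eq_0_iff_char_dvd)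
  thus ?thesis by (simp add: int_eval_def)
qed

section \<open>Exponents at \<open>u = 0\<close>\<close>

text \<open>The action of \<open>\<delta>\<close> on \<open>u powr (s / \<nu>) * f\<close>, divided by \<open>u powr (s / \<nu>)\<close>.\<close>

definition local_op :: "'a::field \<Rightarrow> 'a \<Rightarrow> 'a fps \<Rightarrow> 'a fps" where
  "local_op \<nu> s = twist (fps_const s * (1 - fps_X)) (fps_const \<nu> * fps_X * (1 - fps_X))"

text \<open>The operator with coefficients \<open>a k\<close> in powers of \<delta> kills
  \<open>u powr (s / \<nu>) * f\<close>; only the power series part is written down.\<close>

definition annihilates :: "'a::field \<Rightarrow> (nat \<Rightarrow> 'a fps) \<Rightarrow> 'a \<Rightarrow> 'a fps \<Rightarrow> bool" where
  "annihilates \<nu> a s f \<longleftrightarrow> (\<Sum>k<10. a k * (local_op \<nu> s ^^ k) f) = 0"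

lemma annihilates_add:
  "annihilates \<nu> a s f \<Longrightarrow> annihilates \<nu> a s g \<Longrightarrow> annihilates \<nu> a s (f + g)"
  by (simp add: annihilates_def local_op_def twist_power_add distrib_left sum.distrib)

lemma annihilates_const:
  assumes "annihilates \<nu> a s f"
  shows "annihilates \<nu> a s (fps_const c * f)"
proof -
  have "(\<Sum>k<10. a k * (local_op \<nu> s ^^ k) (fps_const c * f)) =
      fps_const c * (\<Sum>k<10. a k * (local_op \<nu> s ^^ k) f)"
    unfolding local_op_def twist_power_const sum_distrib_left by (simp add: mult.left_commute)
  thus ?thesis using assms by (simp add: annihilates_def)
qed

lemma annihilates_diff:
  assumes "annihilates \<nu> a s f" "annihilates \<nu> a s g"
  shows "annihilates \<nu> a s (f - g)"
  using annihilates_add[OF assms(1) annihilates_const[OF assms(2), of "-1"]]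
  by (simp flip: fps_const_neg)

text \<open>A factor \<open>u ^ m\<close> can be moved into the fractional power of u, where it
  raises s by m \<nu>.\<close>

lemma local_op_shift: "local_op \<nu> s (fps_X ^ m * f) = fps_X ^ m * local_op \<nu> (s + of_nat m * \<nu>) f"
proof -
  have "fps_X * fps_deriv (fps_X ^ m :: 'a fps) = of_nat m * fps_X ^ m"
    by (induction m) (simp_all add: algebra_simps)
  hence "fps_const \<nu> * fps_X * (1 - fps_X) * (fps_deriv (fps_X ^ m) * f)
      = fps_const \<nu> * (1 - fps_X) * (of_nat m * fps_X ^ m) * f"
    by (metis (no_types, lifting) mult.assoc mult.commute)
  moreover have "fps_const (s + of_nat m * \<nu>) = fps_const s + of_nat m * fps_const \<nu>"
    by (simp flip: fps_of_nat)
  ultimately show ?thesis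
    by (simp add: local_op_def twist_def algebra_simps)
qed

lemma annihilates_shift:
  "annihilates \<nu> a s (fps_X ^ m * f) \<longleftrightarrow> annihilates \<nu> a (s + of_nat m * \<nu>) f"
proof -
  have *: "(local_op \<nu> s ^^ k) (fps_X ^ m * f) = fps_X ^ m * (local_op \<nu> (s + of_nat m * \<nu>) ^^ k) f"
    for k by (induction k) (simp_all add: local_op_shift)
  have "(\<Sum>k<10. a k * (local_op \<nu> s ^^ k) (fps_X ^ m * f)) =
      fps_X ^ m * (\<Sum>k<10. a k * (local_op \<nu> (s + of_nat m * \<nu>) ^^ k) f)"
    unfolding * sum_distrib_left by (simp add: mult.left_commute)
  thus ?thesis by (simp add: annihilates_def)
qed

definition indicial_poly :: "(nat \<Rightarrow> 'a::field fps) \<Rightarrow> 'a poly" where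
  "indicial_poly a = (\<Sum>k<10. monom (a k $ 0) k)"

text \<open>Modulo u, \<delta> multiplies the leading term by s, so the leading coefficient of the
  equation is the indicial polynomial at s times \<open>f $ 0\<close>.\<close>

lemma indicial_root:
  assumes "annihilates \<nu> a s f" "f $ 0 \<noteq> 0"
  shows "poly (indicial_poly a) s = 0"
proof -
  have *: "(local_op \<nu> s ^^ k) f $ 0 = s ^ k * f $ 0" for k
    by (induction k) (simp_all add: local_op_def twist_def)
  have "0 = (\<Sum>k<10. a k * (local_op \<nu> s ^^ k) f) $ 0"
    using assms(1) by (simp add: annihilates_def)
  also have "\<dots> = (\<Sum>k<10. a k $ 0 * s ^ k) * f $ 0"
    by (simp add: fps_sum_nth * sum_distrib_right mult.assoc)
  finally show ?thesis
    using assms(2) by (simp add: indicial_poly_def poly_sum poly_monom)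
qed

lemma indicial_card_roots:
  assumes "\<exists>k<10. a k $ 0 \<noteq> 0"
    and S: "\<And>s. s \<in> S \<Longrightarrow> \<exists>f. f $ 0 \<noteq> 0 \<and> annihilates \<nu> a s f"
  shows "card S < 10"
proof -
  let ?A = "indicial_poly a"
  have coeff: "coeff ?A i = a i $ 0" if "i < 10" for i
    using that by (simp add: indicial_poly_def coeff_sum)
  have A: "?A \<noteq> 0" using assms(1) coeff by (metis coeff_0)
  have "degree ?A \<le> 9"
    by (rule degree_le) (auto simp: indicial_poly_def coeff_sum)
  moreover have "card {s. poly ?A s = 0} \<le> degree ?A"
    by (rule card_poly_roots_bound[OF A])
  moreover have "card S \<le> card {s. poly ?A s = 0}"
    using S indicial_root by (intro card_mono poly_roots_finite[OF A]) blast
  ultimately show ?thesis by linarith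
qed

text \<open>Divides out the least order of vanishing among the entries. This normalises a kernel
  vector so that its indicial polynomial is nonzero.\<close>

lemma fps_common_X_power:
  fixes v :: "nat \<Rightarrow> 'a::field fps"
  assumes "\<exists>i<n. v i \<noteq> 0"
  obtains m w where "\<And>i. i < n \<Longrightarrow> v i = fps_X ^ m * w i" "\<exists>i<n. w i $ 0 \<noteq> 0"
proof -
  let ?D = "{subdegree (v i) | i. i < n \<and> v i \<noteq> 0}"
  have D: "finite ?D" "?D \<noteq> {}" using assms by auto
  define m where "m = Min ?D"
  from Min_in[OF D] obtain i where i: "i < n" "v i \<noteq> 0" "subdegree (v i) = m"
    unfolding m_def by auto
  have le: "m \<le> subdegree (v i)" if "i < n" "v i \<noteq> 0" for i
    unfolding m_def using D that by (intro Min_le) auto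
  show thesis
  proof (rule that[of m "\<lambda>i. fps_shift m (v i)"])
    show "v i = fps_X ^ m * fps_shift m (v i)" if "i < n" for i
      using le[OF that] fps_shift_times_fps_X_power[of m "v i"]
      by (cases "v i = 0") (simp_all add: mult.commute)
    show "\<exists>i<n. fps_shift m (v i) $ 0 \<noteq> 0"
      using i by (intro exI[of _ i]) auto
  qed
qed

text \<open>Rows are indexed by powers of \<delta>, so a left kernel vector is a differential
  operator that kills all ten monomials.\<close>

lemma wron_mat_left_kernel:
  fixes n :: nat
  assumes "int_eval (fps_X :: 'a::field fps) (det (wron_mat n)) = 0"
  obtains a :: "nat \<Rightarrow> 'a::field fps" where "\<exists>k<10. a k $ 0 \<noteq> 0"
    "\<And>c. c < 10 \<Longrightarrow>
       (\<Sum>k<10. a k * int_eval fps_X (wron_poly n (fst (mono_exp c)) (snd (mono_exp c)) k)) = 0"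
proof -
  define M where
    "M k c = int_eval (fps_X :: 'a fps) (wron_poly n (fst (mono_exp c)) (snd (mono_exp c)) k)" for k c
  have "mat 10 10 (\<lambda>(k, c). M k c) = map_mat (int_eval fps_X) (wron_mat n)"
    by (intro eq_matI) (auto simp: M_def wron_mat_def)
  hence "det (mat 10 10 (\<lambda>(k, c). M k c)) = 0"
    using assms by (simp add: comm_ring_hom.hom_det[OF comm_ring_hom_int_eval])
  then obtain v where v: "\<exists>k<10. v k \<noteq> 0" "\<And>c. c < 10 \<Longrightarrow> (\<Sum>k<10. v k * M k c) = 0"
    by (rule det_eq_0_left_kernel) blast
  from fps_common_X_power[OF v(1)] obtain m a
    where a: "\<And>k. k < 10 \<Longrightarrow> v k = fps_X ^ m * a k" "\<exists>k<10. a k $ 0 \<noteq> 0" by blast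
  have "(\<Sum>k<10. a k * M k c) = 0" if "c < 10" for c
  proof -
    have "fps_X ^ m * (\<Sum>k<10. a k * M k c) = (\<Sum>k<10. v k * M k c)"
      unfolding sum_distrib_left by (intro sum.cong refl) (simp add: a(1) mult.assoc)
    thus ?thesis using v(2)[OF that] by simp
  qed
  thus thesis using a(2) that unfolding M_def by blast
qed

lemma mono_exp_surj:
  assumes "i + j \<le> 3" shows "\<exists>c<10. mono_exp c = (i, j)"
proof -
  have "i = 0 \<or> i = 1 \<or> i = 2 \<or> i = 3" "j = 0 \<or> j = 1 \<or> j = 2 \<or> j = 3"
    using assms by linarith+
  hence "(i, j) \<in> set cubic_monos"
    using assms by (elim disjE) (simp_all add: cubic_monos_def)
  moreover have "length cubic_monos = 10" by (simp add: cubic_monos_def)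
  ultimately obtain c where "c < 10" "cubic_monos ! c = (i, j)" by (metis in_set_conv_nth)
  thus ?thesis unfolding mono_exp_def by blast
qed

text \<open>\<open>W\<close> stands for y as a series in u; this is \<delta> y = - u y with the
  factor u cancelled.\<close>

lemma fps_root_one_minus_X_deriv:
  fixes W :: "'a::field fps"
  assumes n: "of_nat n \<noteq> (0::'a)" and W: "W ^ n = 1 - fps_X"
  shows "of_nat n * (1 - fps_X) * fps_deriv W = - W"
proof -
  have n0: "n > 0" using n by (cases n) auto
  have "fps_deriv (W ^ n) = -1" using W by simp
  hence "W * (of_nat n * (fps_deriv W * W ^ (n - 1))) = - W"
    by (simp add: fps_deriv_power fps_of_nat mult.assoc)
  hence *: "of_nat n * (W * W ^ (n - 1)) * fps_deriv W = - W"
    by (simp add: mult_ac)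
  have "W * W ^ (n - 1) = 1 - fps_X" using n0 W by (simp flip: power_Suc)
  thus ?thesis using * by simp
qed

text \<open>Locally x is the n-th root of u, so the monomial with exponents i and j has fractional
  part \<open>s = i\<close> and series part \<open>W ^ j\<close>. Its iterates under \<delta> are
  given by \<open>wron_poly\<close>, and the kernel relation applies.\<close>

lemma annihilates_power:
  fixes W :: "'a::field fps"
  assumes n: "of_nat n \<noteq> (0::'a)" and W: "W ^ n = 1 - fps_X"
    and ker: "\<And>c. c < 10 \<Longrightarrow>
       (\<Sum>k<10. a k * int_eval fps_X (wron_poly n (fst (mono_exp c)) (snd (mono_exp c)) k)) = 0"
    and "i + j \<le> 3"
  shows "annihilates (of_nat n) a (of_nat i) (W ^ j)"
proof -
  note W' = fps_root_one_minus_X_deriv[OF n W]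
  have Wj: "of_nat n * (1 - fps_X) * fps_deriv (W ^ j) = - of_nat j * W ^ j"
  proof (cases j)
    case (Suc l)
    have "of_nat n * (1 - fps_X) * fps_deriv (W ^ j)
        = of_nat j * W ^ l * (of_nat n * (1 - fps_X) * fps_deriv W)"
      by (simp add: Suc fps_deriv_power fps_of_nat algebra_simps del: power_Suc of_nat_Suc)
    thus ?thesis unfolding W' by (simp add: Suc algebra_simps)
  qed simp
  let ?w = "fps_const (of_nat i) * (1 - fps_X) :: 'a fps"
    and ?c = "fps_const (of_nat n) * fps_X * (1 - fps_X) :: 'a fps"
  have B: "twist ?w ?c (W ^ j) = (of_nat i * (1 - fps_X) - of_nat j * fps_X) * W ^ j"
  proof -
    have "twist ?w ?c (W ^ j) = of_nat i * (1 - fps_X) * W ^ j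
        + fps_X * (of_nat n * (1 - fps_X) * fps_deriv (W ^ j))"
      by (simp add: twist_def fps_of_nat mult_ac)
    thus ?thesis unfolding Wj by (simp add: algebra_simps)
  qed
  have U: "?c * fps_deriv fps_X = of_nat n * fps_X * (1 - fps_X)"
    by (simp add: fps_of_nat)
  have pow: "(local_op (of_nat n) (of_nat i) ^^ k) (W ^ j) = int_eval fps_X (wron_poly n i j k) * W ^ j" for k
    unfolding local_op_def by (rule twist_power_eq_wron_poly[OF U B])
  from mono_exp_surj[OF assms(4)] obtain c where c: "c < 10" "mono_exp c = (i, j)" by blast
  have "(\<Sum>k<10. a k * (int_eval fps_X (wron_poly n i j k) * W ^ j))
      = (\<Sum>k<10. a k * int_eval fps_X (wron_poly n i j k)) * W ^ j"
    by (simp add: sum_distrib_right mult.assoc)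
  thus ?thesis using ker[OF c(1)] c(2) by (simp add: annihilates_def pow)
qed

text \<open>The exponent \<open>j\<close> stays general because splitting off one factor
  \<open>1 - W\<close> raises it in one of the two terms.\<close>

lemma annihilates_one_minus_power:
  fixes W :: "'a::field fps"
  assumes "\<And>j. j \<le> m \<Longrightarrow> annihilates \<nu> a s (W ^ j)" and "j + l \<le> m"
  shows "annihilates \<nu> a s (W ^ j * (1 - W) ^ l)"
  using assms(2)
proof (induction l arbitrary: j)
  case (Suc l)
  have "W ^ j * (1 - W) ^ Suc l = W ^ j * (1 - W) ^ l - W ^ Suc j * (1 - W) ^ l"
    by (simp add: algebra_simps)
  thus ?case using Suc annihilates_diff by (metis add_Suc add_Suc_right Suc_leD)
qed (use assms in auto)

section \<open>Coinciding exponents\<close>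

lemma fps_square_coeffs:
  fixes f :: "'a::field fps"
  assumes "f $ 0 = 0"
  shows "(f ^ 2) $ 0 = 0" "(f ^ 2) $ 1 = 0" "(f ^ 2) $ 2 = (f $ 1)\<^sup>2"
    "(f ^ 2) $ 3 = 2 * f $ 1 * f $ 2" "(f ^ 2) $ 4 = 2 * f $ 1 * f $ 3 + (f $ 2)\<^sup>2"
    "(f ^ 2) $ 5 = 2 * f $ 1 * f $ 4 + 2 * f $ 2 * f $ 3"
    "(f ^ 2) $ 6 = 2 * f $ 1 * f $ 5 + 2 * f $ 2 * f $ 4 + (f $ 3)\<^sup>2"
  using assms by (simp_all add: power2_eq_square fps_mult_nth eval_nat_numeral)

lemma fps_cube_coeffs:
  fixes f :: "'a::field fps"
  assumes "f $ 0 = 0"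
  shows "(f ^ 3) $ 0 = 0" "(f ^ 3) $ 1 = 0" "(f ^ 3) $ 2 = 0" "(f ^ 3) $ 3 = (f $ 1) ^ 3"
    "(f ^ 3) $ 4 = 3 * (f $ 1)\<^sup>2 * f $ 2"
    "(f ^ 3) $ 5 = 3 * (f $ 1)\<^sup>2 * f $ 3 + 3 * f $ 1 * (f $ 2)\<^sup>2"
proof -
  obtain g where g: "g = f ^ 2" by blast
  have f3: "f ^ 3 = f * g" by (simp only: g power2_eq_square power3_eq_cube mult.assoc)
  show "(f ^ 3) $ 0 = 0" "(f ^ 3) $ 1 = 0" "(f ^ 3) $ 2 = 0" "(f ^ 3) $ 3 = (f $ 1) ^ 3"
    "(f ^ 3) $ 4 = 3 * (f $ 1)\<^sup>2 * f $ 2"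
    "(f ^ 3) $ 5 = 3 * (f $ 1)\<^sup>2 * f $ 3 + 3 * f $ 1 * (f $ 2)\<^sup>2"
    unfolding f3 using assms fps_square_coeffs[OF assms, folded g]
    by (simp_all add: fps_mult_nth[of f g] eval_nat_numeral algebra_simps)
qed

lemma inj_on_of_int_if_small:
  assumes "\<And>m m'. m \<in> M \<Longrightarrow> m' \<in> M \<Longrightarrow> \<bar>m - m'\<bar> < int CHAR('a)"
  shows "inj_on (of_int :: int \<Rightarrow> 'a::ring_1) M"
proof (rule inj_onI)
  fix m m' assume m: "m \<in> M" "m' \<in> M" "of_int m = (of_int m' :: 'a)"
  hence "of_int (m - m') = (0::'a)" by simp
  hence "int CHAR('a) dvd m - m'" by (metis of_int_eq_0_iff_char_dvd)
  thus "m = m'" using assms(1)[OF m(1,2)] zdvd_imp_le[of "int CHAR('a)" "\<bar>m - m'\<bar>"]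
    by (cases "m = m'") auto
qed

text \<open>The situation at u = 0: \<open>W\<close> is the branch of y with value 1,
  \<open>a\<close> the operator, and \<nu> the image of n in the field.\<close>

locale local_kernel =
  fixes n :: nat and a :: "nat \<Rightarrow> 'a::field fps" and W :: "'a fps" and \<nu> :: 'a
  assumes nu: "\<nu> = of_nat n" and nu0: "\<nu> \<noteq> 0"
    and W: "W ^ n = 1 - fps_X" and W0: "W $ 0 = 1"
    and a: "\<exists>k<10. a k $ 0 \<noteq> 0"
    and ann_W: "i + j \<le> 3 \<Longrightarrow> annihilates \<nu> a (of_nat i) (W ^ j)"
begin

text \<open>The usual exponent at u = 0 multiplied by \<nu>, so that x has exponent 1 and u has
  exponent \<nu>.\<close>

definition exponent :: "'a \<Rightarrow> bool" where
  "exponent s \<longleftrightarrow> (\<exists>f. f $ 0 \<noteq> 0 \<and> annihilates \<nu> a s f)"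

definition z :: "'a fps" where "z = 1 - W"

definition zeta :: "'a fps" where "zeta = fps_shift 1 z"

lemma card_exponents: "(\<And>s. s \<in> S \<Longrightarrow> exponent s) \<Longrightarrow> card S < 10"
  by (rule indicial_card_roots[OF a, of _ \<nu>]) (auto simp: exponent_def)

text \<open>The recursion of the binomial series for the n-th root of 1 - u, read off from its
  differential equation.\<close>

lemma W_rec: "\<nu> * of_nat (Suc k) * W $ Suc k = (\<nu> * of_nat k - 1) * W $ k"
proof -
  have "(of_nat n * (1 - fps_X) * fps_deriv W) $ k = (- W) $ k"
    using fps_root_one_minus_X_deriv[OF _ W] nu nu0 by simp
  moreover have "of_nat n * (1 - fps_X) * fps_deriv W
      = fps_const \<nu> * (fps_deriv W - fps_X * fps_deriv W)"
    by (simp add: nu fps_of_nat algebra_simps)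
  ultimately have "\<nu> * (fps_deriv W $ k - (fps_X * fps_deriv W) $ k) = - (W $ k)" by simp
  thus ?thesis by (cases k) (simp_all add: algebra_simps)
qed

lemma z_0: "z $ 0 = 0"
  by (simp add: z_def W0)

lemma z_Suc: "z $ Suc k = - (W $ Suc k)"
  by (simp add: z_def)

lemma z_eq: "z = fps_X * zeta"
  by (rule fps_ext) (simp add: zeta_def z_0)

lemma zeta_nth: "zeta $ k = z $ Suc k"
  by (simp add: zeta_def)

lemma zeta_0: "zeta $ 0 \<noteq> 0"
  using W_rec[of 0] by (auto simp: zeta_nth z_Suc W0)

lemma ann_z: "i + m \<le> 3 \<Longrightarrow> annihilates \<nu> a (of_nat i) (z ^ m)"
  using annihilates_one_minus_power[of "3 - i" \<nu> a "of_nat i" W 0 m] ann_W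
  by (simp add: z_def)

lemma ann_zeta: "i + m \<le> 3 \<Longrightarrow> annihilates \<nu> a (of_nat i + of_nat m * \<nu>) (zeta ^ m)"
  using ann_z by (simp add: z_eq power_mult_distrib annihilates_shift)

lemma exponent_basic: "i + m \<le> 3 \<Longrightarrow> exponent (of_nat i + of_nat m * \<nu>)"
  unfolding exponent_def using ann_zeta zeta_0
  by (intro exI[of _ "zeta ^ m"]) (simp add: fps_power_zeroth)

lemma exponents_basic:
  "exponent 0" "exponent 1" "exponent 2" "exponent 3" "exponent \<nu>" "exponent (1 + \<nu>)"
  "exponent (2 + \<nu>)" "exponent (2 * \<nu>)" "exponent (1 + 2 * \<nu>)" "exponent (3 * \<nu>)"
  using exponent_basic[of 0 0] exponent_basic[of 1 0] exponent_basic[of 2 0] exponent_basic[of 3 0]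
    exponent_basic[of 0 1] exponent_basic[of 1 1] exponent_basic[of 2 1]
    exponent_basic[of 0 2] exponent_basic[of 1 2] exponent_basic[of 0 3] by simp_all

text \<open>A solution without fractional part that vanishes to order exactly m in u has exponent m
  \<nu>.\<close>

lemma exponent_shift:
  assumes "annihilates \<nu> a 0 g" "\<And>r. r < m \<Longrightarrow> g $ r = 0" "g $ m \<noteq> 0"
  shows "exponent (of_nat m * \<nu>)"
proof -
  have "g = fps_X ^ m * fps_shift m g"
    using assms(2) by (intro fps_ext) (simp add: fps_X_power_mult_nth)
  hence "annihilates \<nu> a (0 + of_nat m * \<nu>) (fps_shift m g)"
    using assms(1) annihilates_shift by metis
  thus ?thesis using assms(3) unfolding exponent_def by (intro exI[of _ "fps_shift m g"]) simp
qed

text \<open>When two basic exponents coincide, \<open>e\<close> is an extra solution with s = 0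
  besides the powers of \<open>z\<close>; a combination can then vanish to a new order.\<close>

lemma ann_combination:
  assumes "annihilates \<nu> a 0 e"
  shows "annihilates \<nu> a 0 (fps_const c * e + fps_const c0 + fps_const c1 * z
           + fps_const c2 * z ^ 2 + fps_const c3 * z ^ 3)"
proof -
  have t: "annihilates \<nu> a 0 (fps_const b * z ^ m)" if "m \<le> 3" for b m
    using annihilates_const ann_z[of 0 m] that by simp
  show ?thesis
    using t[of 0 c0] t[of 1 c1] t[of 2 c2] t[of 3 c3] annihilates_const[OF assms, of c]
    by (simp add: annihilates_add)
qed

text \<open>Scaling by \<open>d\<close> clears denominators and makes the exponents images of
  integers. Distinct integers that differ by less than the characteristic stay distinct in the
  field, against the bound on the number of exponents.\<close>

lemma no_ten_exponents:
  assumes "\<forall>s\<in>set L. exponent s" "map (\<lambda>s. d * s) L = map of_int K" "distinct K" "length K = 10"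
    and "\<forall>m\<in>set K. \<forall>m'\<in>set K. \<bar>m - m'\<bar> < int CHAR('a)"
  shows False
proof -
  have "distinct (map (of_int :: int \<Rightarrow> 'a) K)"
    using assms(3,5) inj_on_of_int_if_small[of "set K", where 'a = 'a] by (simp add: distinct_map)
  hence "distinct (map (\<lambda>s. d * s) L)" unfolding assms(2) .
  hence "distinct L" unfolding distinct_map by blast
  moreover have "length (map (\<lambda>s. d * s) L) = 10" unfolding assms(2) length_map by (rule assms(4))
  hence "length L = 10" unfolding length_map .
  ultimately have "card (set L) = 10" by (simp add: distinct_card)
  thus False using card_exponents[of "set L"] assms(1) by simp
qed

lemma exponent_4:
  assumes "annihilates \<nu> a 0 g" "g $ 0 = 0" "g $ 1 = 0" "g $ 2 = 0" "g $ 3 = 0" "g $ 4 \<noteq> 0"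
  shows "exponent (4 * \<nu>)"
proof -
  have "g $ r = 0" if "r < 4" for r
  proof -
    have "r = 0 \<or> r = 1 \<or> r = 2 \<or> r = 3" using that by linarith
    thus ?thesis using assms(2-5) by (elim disjE) (hypsubst, assumption)+
  qed
  hence "exponent (of_nat 4 * \<nu>)" by (rule exponent_shift[OF assms(1) _ assms(6)])
  thus ?thesis by simp
qed

lemma exponent_5:
  assumes "annihilates \<nu> a 0 g" "g $ 0 = 0" "g $ 1 = 0" "g $ 2 = 0" "g $ 3 = 0" "g $ 4 = 0" "g $ 5 \<noteq> 0"
  shows "exponent (5 * \<nu>)"
proof -
  have "g $ r = 0" if "r < 5" for r
  proof -
    have "r = 0 \<or> r = 1 \<or> r = 2 \<or> r = 3 \<or> r = 4"
      using that by (simp add: less_Suc_eq eval_nat_numeral disj_ac)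
    thus ?thesis using assms(2-6) by (elim disjE) (hypsubst, assumption)+
  qed
  hence "exponent (of_nat 5 * \<nu>)" by (rule exponent_shift[OF assms(1) _ assms(7)])
  thus ?thesis by simp
qed

lemma W_recs: "\<nu> * W $ 1 = -1" "2 * \<nu> * W $ 2 = (\<nu> - 1) * W $ 1"
  "3 * \<nu> * W $ 3 = (2 * \<nu> - 1) * W $ 2" "4 * \<nu> * W $ 4 = (3 * \<nu> - 1) * W $ 3"
  "5 * \<nu> * W $ 5 = (4 * \<nu> - 1) * W $ 4"
proof -
  have r: "of_nat m * \<nu> * W $ m = (of_nat (m - 1) * \<nu> - 1) * W $ (m - 1)" if "m > 0" for m
    using W_rec[of "m - 1"] that by (cases m) (simp_all add: mult_ac)
  show "\<nu> * W $ 1 = -1" using r[of 1] by (simp add: W0)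
  show "2 * \<nu> * W $ 2 = (\<nu> - 1) * W $ 1" using r[of 2] by simp
  show "3 * \<nu> * W $ 3 = (2 * \<nu> - 1) * W $ 2" using r[of 3] by simp
  show "4 * \<nu> * W $ 4 = (3 * \<nu> - 1) * W $ 3" using r[of 4] by simp
  show "5 * \<nu> * W $ 5 = (4 * \<nu> - 1) * W $ 4" using r[of 5] by simp
qed

lemma z_nth: "z $ 1 = - (W $ 1)" "z $ 2 = - (W $ 2)" "z $ 3 = - (W $ 3)" "z $ 4 = - (W $ 4)"
  "z $ 5 = - (W $ 5)"
  using z_Suc[of 0] z_Suc[of 1] z_Suc[of 2] z_Suc[of 3] z_Suc[of 4] by (simp_all add: eval_nat_numeral)

lemmas zp_nth = z_0 z_nth fps_square_coeffs[OF z_0] fps_cube_coeffs[OF z_0]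

end

section \<open>Characteristic above 11: the four coincidences and the distinctness of the
  exponents\<close>

locale local_kernel_large_char = local_kernel +
  assumes p: "prime CHAR('a)" "CHAR('a) > 11"
begin

lemma of_nat_ne_0: "0 < m \<Longrightarrow> m \<le> 11 \<Longrightarrow> of_nat m \<noteq> (0::'a)"
  using p(2) dvd_imp_le[of "CHAR('a)" m] unfolding of_nat_eq_0_iff_char_dvd by linarith

lemma small_numerals_ne_0 [simp]: "(2::'a) \<noteq> 0" "(3::'a) \<noteq> 0" "(5::'a) \<noteq> 0"
  using of_nat_ne_0[of 2] of_nat_ne_0[of 3] of_nat_ne_0[of 5] by simp_all

lemma even_numeral_eq_0 [simp]: "numeral (Num.Bit0 w) = (0::'a) \<longleftrightarrow> numeral w = (0::'a)"
proof -
  have "numeral (Num.Bit0 w) = 2 * (numeral w :: 'a)" by (subst numeral_Bit0) (rule mult_2[symmetric])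
  thus ?thesis using small_numerals_ne_0(1) by (simp only: mult_eq_0_iff simp_thms)
qed

lemma odd_numerals_ne_0 [simp]: "(9::'a) \<noteq> 0" "(27::'a) \<noteq> 0" "(81::'a) \<noteq> 0" "(243::'a) \<noteq> 0"
  "(729::'a) \<noteq> 0" "(19683::'a) \<noteq> 0" "(1594323::'a) \<noteq> 0"
  using power_not_zero[OF small_numerals_ne_0(2), of 2] power_not_zero[OF small_numerals_ne_0(2), of 3]
    power_not_zero[OF small_numerals_ne_0(2), of 4] power_not_zero[OF small_numerals_ne_0(2), of 5]
    power_not_zero[OF small_numerals_ne_0(2), of 6]
    power_not_zero[OF small_numerals_ne_0(2), of 9] power_not_zero[OF small_numerals_ne_0(2), of 13]
    by simp_all

text \<open>For 2 \<nu> = 3 the scaled exponents range from 0 to 12, so the characteristic has to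
  exceed 12; primality excludes 12 itself.\<close>

lemma CHAR_ge_13: "CHAR('a) \<ge> 13"
proof -
  have "CHAR('a) \<noteq> 12" using p(1) prime_nat_not_dvd[of 12 2] by auto
  thus ?thesis using p(2) by linarith
qed

lemma W_eqs: "W $ 1 = - 1 / \<nu>" "W $ 2 = (\<nu> - 1) * W $ 1 / (2 * \<nu>)"
  "W $ 3 = (2 * \<nu> - 1) * W $ 2 / (3 * \<nu>)" "W $ 4 = (3 * \<nu> - 1) * W $ 3 / (4 * \<nu>)"
  "W $ 5 = (4 * \<nu> - 1) * W $ 4 / (5 * \<nu>)"
proof -
  have div: "u = v / w" if "w * u = v" "w \<noteq> 0" for u v w :: 'a
    using that by (simp add: nonzero_eq_divide_eq mult.commute)
  show "W $ 1 = - 1 / \<nu>" by (rule div[OF W_recs(1) nu0])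
  show "W $ 2 = (\<nu> - 1) * W $ 1 / (2 * \<nu>)" by (rule div[OF W_recs(2)]) (simp add: nu0)
  show "W $ 3 = (2 * \<nu> - 1) * W $ 2 / (3 * \<nu>)" by (rule div[OF W_recs(3)]) (simp add: nu0)
  show "W $ 4 = (3 * \<nu> - 1) * W $ 3 / (4 * \<nu>)" by (rule div[OF W_recs(4)]) (simp add: nu0)
  show "W $ 5 = (4 * \<nu> - 1) * W $ 4 / (5 * \<nu>)" by (rule div[OF W_recs(5)]) (simp add: nu0)
qed

text \<open>In the next four lemmas the coefficients of \<open>?g\<close> are found by eliminating its low-order terms
  against \<open>1\<close>, \<open>z\<close>, \<open>z\<^sup>2\<close> and \<open>z ^ 3\<close>.\<close>

lemma nu_ne_minus_2: "\<nu> \<noteq> -2"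
proof
  assume nu_eq: "\<nu> = -2"
  have W1: "W $ 1 = 1/2" unfolding W_eqs by (simp add: nu_eq)
  have W2: "W $ 2 = 3/8" unfolding W_eqs(2) W1 by (simp add: nu_eq field_simps)
  have W3: "W $ 3 = 5/16" unfolding W_eqs(3) W2 by (simp add: nu_eq field_simps)
  have W4: "W $ 4 = 35/128" unfolding W_eqs(4) W3 by (simp add: nu_eq field_simps)
  have W5: "W $ 5 = 63/256" unfolding W_eqs(5) W4 by (simp add: nu_eq field_simps)
  \<comment> \<open>The coincidence is 2 + \<nu> = 0: the solution \<open>x ^ 2 * z\<close> has no
    fractional part left and becomes \<open>zeta\<close>. The new exponent 4 \<nu> replaces 2 +
    \<nu>.\<close>
  have "annihilates \<nu> a 0 zeta" using ann_zeta[of 2 1] by (simp add: nu_eq)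
  note g = ann_combination[OF this, of 16 8 "-12" 2 1]
  let ?g = "fps_const 16 * zeta + fps_const 8 + fps_const (- 12) * z + fps_const 2 * z\<^sup>2
    + fps_const 1 * z ^ 3"
  have "zeta $ 0 = z $ 1" "zeta $ 1 = z $ 2" "zeta $ 2 = z $ 3" "zeta $ 3 = z $ 4" "zeta $ 4 = z $ 5"
    by (simp_all add: zeta_nth eval_nat_numeral)
  note nths = this zp_nth W1 W2 W3 W4 W5
  have "?g $ 0 = 0" "?g $ 1 = 0" "?g $ 2 = 0" "?g $ 3 = 0" "?g $ 4 \<noteq> 0"
    by (simp_all only: fps_add_nth fps_mult_left_const_nth nths)
      (simp_all add: field_simps power2_eq_square power3_eq_cube)
  hence "exponent (4 * \<nu>)"
    by (rule exponent_4[OF g])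
  with exponents_basic have "\<forall>s\<in>set [0, 1, 2, 3, \<nu>, 1 + \<nu>, 2 * \<nu>, 1 + 2 * \<nu>, 3 * \<nu>, 4 * \<nu>]. exponent s" by simp
  thus False
    by (rule no_ten_exponents[of _ 1 "[0, 1, 2, 3, -2, -1, -4, -3, -6, -8]"])
      (use CHAR_ge_13 in \<open>simp_all add: nu_eq field_simps\<close>)
qed

lemma two_nu_ne_3: "2 * \<nu> \<noteq> 3"
proof
  assume "2 * \<nu> = 3"
  hence nu_eq: "\<nu> = 3 / 2" by (simp add: field_simps)
  have W1: "W $ 1 = - (2/3)" unfolding W_eqs by (simp add: nu_eq)
  have W2: "W $ 2 = - (1/9)" unfolding W_eqs(2) W1 by (simp add: nu_eq field_simps)
  have W3: "W $ 3 = - (4/81)" unfolding W_eqs(3) W2 by (simp add: nu_eq field_simps)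
  have W4: "W $ 4 = - (7/243)" unfolding W_eqs(4) W3 by (simp add: nu_eq field_simps)
  \<comment> \<open>The coincidence is 3 = 2 \<nu>: the solution \<open>x ^ 3\<close> becomes
    \<open>u ^ 2\<close>. The new exponent 4 \<nu> replaces 2 \<nu>.\<close>
  have shift: "0 + of_nat 2 * \<nu> = of_nat 3" by (simp add: nu_eq field_simps)
  have "annihilates \<nu> a 0 (fps_X ^ 2 * 1)"
    unfolding annihilates_shift shift using ann_z[of 3 0] by simp
  note g = ann_combination[OF this, of 8 0 0 "-18" 9]
  let ?g = "fps_const 8 * (fps_X ^ 2 * 1) + fps_const 0 + fps_const 0 * z
    + fps_const (-18) * z\<^sup>2 + fps_const 9 * z ^ 3"
  note nths = zp_nth W1 W2 W3 W4 fps_X_power_mult_nth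
  have "?g $ 0 = 0" "?g $ 1 = 0" "?g $ 2 = 0" "?g $ 3 = 0" "?g $ 4 = - (2 / 27)"
    by (simp_all only: fps_add_nth fps_mult_left_const_nth nths)
      (simp_all add: field_simps power2_eq_square power3_eq_cube)
  moreover from this(5) have "?g $ 4 \<noteq> 0" by (simp only: neg_equal_0_iff_equal divide_eq_0_iff) simp
  ultimately have "exponent (4 * \<nu>)"
    by (intro exponent_4[OF g])
  with exponents_basic have "\<forall>s\<in>set [0, 1, 2, 3, \<nu>, 1 + \<nu>, 2 + \<nu>, 1 + 2 * \<nu>, 3 * \<nu>, 4 * \<nu>]. exponent s" by simp
  thus False
    by (rule no_ten_exponents[of _ 2 "[0, 2, 4, 6, 3, 5, 7, 8, 9, 12]"])
      (use CHAR_ge_13 in \<open>simp_all add: nu_eq field_simps\<close>)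
qed

lemma two_nu_ne_minus_1: "2 * \<nu> \<noteq> -1"
proof
  assume "2 * \<nu> = -1"
  hence nu_eq: "\<nu> = - 1 / 2" by (simp add: field_simps)
  have W1: "W $ 1 = 2" unfolding W_eqs by (simp add: nu_eq)
  have W2: "W $ 2 = 3" unfolding W_eqs(2) W1 by (simp add: nu_eq field_simps)
  have W3: "W $ 3 = 4" unfolding W_eqs(3) W2 by (simp add: nu_eq field_simps)
  have W4: "W $ 4 = 5" unfolding W_eqs(4) W3 by (simp add: nu_eq field_simps)
  have W5: "W $ 5 = 6" unfolding W_eqs(5) W4 by (simp add: nu_eq field_simps)
  \<comment> \<open>The coincidence is 1 + 2 \<nu> = 0: the solution \<open>x * z ^ 2\<close>
    becomes \<open>zeta ^ 2\<close>. The new exponent 4 \<nu> replaces 1 + 2 \<nu>.\<close>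
  have "annihilates \<nu> a 0 (zeta ^ 2)" using ann_zeta[of 1 2] by (simp add: nu_eq)
  note g = ann_combination[OF this, of 8 "-32" 48 "-14" "-1"]
  let ?g = "fps_const 8 * zeta ^ 2 + fps_const (-32) + fps_const 48 * z + fps_const (-14) * z\<^sup>2
    + fps_const (-1) * z ^ 3"
  have "(zeta ^ 2) $ k = (z ^ 2) $ (k + 2)" for k
    by (simp add: z_eq power_mult_distrib fps_X_power_mult_nth)
  from this[of 0] this[of 1] this[of 2] this[of 3] this[of 4]
  have "(zeta ^ 2) $ 0 = (z ^ 2) $ 2" "(zeta ^ 2) $ 1 = (z ^ 2) $ 3" "(zeta ^ 2) $ 2 = (z ^ 2) $ 4"
    "(zeta ^ 2) $ 3 = (z ^ 2) $ 5" "(zeta ^ 2) $ 4 = (z ^ 2) $ 6"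
    by (simp_all add: eval_nat_numeral)
  note nths = this zp_nth W1 W2 W3 W4 W5
  have "?g $ 0 = 0" "?g $ 1 = 0" "?g $ 2 = 0" "?g $ 3 = 0" "?g $ 4 \<noteq> 0"
    by (simp_all only: fps_add_nth fps_mult_left_const_nth nths) simp_all
  hence "exponent (4 * \<nu>)"
    by (rule exponent_4[OF g])
  with exponents_basic have "\<forall>s\<in>set [0, 1, 2, 3, \<nu>, 1 + \<nu>, 2 + \<nu>, 2 * \<nu>, 3 * \<nu>, 4 * \<nu>]. exponent s" by simp
  thus False
    by (rule no_ten_exponents[of _ 2 "[0, 2, 4, 6, -1, 1, 3, -2, -3, -4]"])
      (use CHAR_ge_13 in \<open>simp_all add: nu_eq field_simps\<close>)
qed

lemma three_nu_ne_2: "3 * \<nu> \<noteq> 2"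
proof
  assume "3 * \<nu> = 2"
  hence nu_eq: "\<nu> = 2 / 3" by (simp add: field_simps)
  \<comment> \<open>The coincidence is 3 \<nu> = 2, and \<open>x ^ 2\<close> becomes
    \<open>u ^ 3\<close>. Since 4 \<nu> = 2 + \<nu> is already an exponent, \<open>x ^ 2 * z\<close>
    is used as well to remove order 4, and the new exponent is 5 \<nu>.\<close>
  have shift: "0 + of_nat 3 * \<nu> = of_nat 2" by (simp add: nu_eq)
  have W1: "W $ 1 = - (3/2)" unfolding W_eqs by (simp add: nu_eq)
  have W2: "W $ 2 = 3/8" unfolding W_eqs(2) W1 by (simp add: nu_eq field_simps)
  have W3: "W $ 3 = 1/16" unfolding W_eqs(3) W2 by (simp add: nu_eq field_simps)
  have "annihilates \<nu> a (0 + of_nat 3 * \<nu>) (fps_const 54 * 1 - fps_const 27 * z)"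
    unfolding shift using ann_z[of 2 0] ann_z[of 2 1] by (intro annihilates_diff annihilates_const) simp_all
  hence "annihilates \<nu> a 0 (fps_X ^ 3 * (fps_const 54 * 1 - fps_const 27 * z))"
    unfolding annihilates_shift .
  note g = ann_combination[OF this, of 1 0 0 0 "-16"]
  let ?g = "fps_const 1 * (fps_X ^ 3 * (fps_const 54 * 1 - fps_const 27 * z))
    + fps_const 0 + fps_const 0 * z + fps_const 0 * z\<^sup>2 + fps_const (-16) * z ^ 3"
  note nths = zp_nth W1 W2 W3 fps_X_power_mult_nth
  have z1: "z $ Suc 0 = 3/2" "z $ 2 = - (3/8)" using z_nth(1,2) W1 W2 by simp_all
  have "?g $ 0 = 0" "?g $ 1 = 0" "?g $ 2 = 0" "?g $ 3 = 0" "?g $ 4 = 0" "?g $ 5 \<noteq> 0"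
    by (simp_all only: fps_add_nth fps_mult_left_const_nth nths)
      (simp_all add: z_0 z1 field_simps power2_eq_square power3_eq_cube)
  hence "exponent (5 * \<nu>)"
    by (rule exponent_5[OF g])
  with exponents_basic have "\<forall>s\<in>set [0, 1, 2, 3, \<nu>, 1 + \<nu>, 2 + \<nu>, 2 * \<nu>, 1 + 2 * \<nu>, 5 * \<nu>]. exponent s" by simp
  thus False
    by (rule no_ten_exponents[of _ 3 "[0, 3, 6, 9, 2, 5, 8, 4, 7, 10]"])
      (use CHAR_ge_13 in \<open>simp_all add: nu_eq field_simps\<close>)
qed

text \<open>Reduces the distinctness of two exponents to one excluded equation \<open>d = l\<close>:
  their difference is a nonzero multiple of \<open>d - l\<close>.\<close>

lemma affine_ne: "d \<noteq> l \<Longrightarrow> c \<noteq> 0 \<Longrightarrow> B - A = c * (d - l) \<Longrightarrow> A \<noteq> (B :: 'a)"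
  by auto

lemma nu_exceptional:
  assumes "\<nu> \<noteq> 1" "\<nu> \<noteq> 2" "\<nu> \<noteq> 3" "\<nu> \<noteq> -1" "2 * \<nu> \<noteq> 1" "3 * \<nu> \<noteq> 1"
  shows False
proof -
  note ne = nu0 assms nu_ne_minus_2 two_nu_ne_3 two_nu_ne_minus_1 three_nu_ne_2 small_numerals_ne_0(1,2)
  let ?L = "[0, 1, 2, 3, \<nu>, 1 + \<nu>, 2 + \<nu>, 2 * \<nu>, 1 + 2 * \<nu>, 3 * \<nu>]"
  \<comment> \<open>In the names of these facts the last digit is the factor \<open>c\<close>, and
    the digits before it index the excluded equation in \<open>ne\<close>, with 0 for differences
    that do not involve \<nu>.\<close>
  have D01: "0 \<noteq> (1::'a)" "1 \<noteq> (2::'a)" "2 \<noteq> (3::'a)"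
    by (rule affine_ne[OF one_neq_zero one_neq_zero]; simp)+
  have D02: "0 \<noteq> (2::'a)" "1 \<noteq> (3::'a)"
    by (rule affine_ne[OF one_neq_zero small_numerals_ne_0(1)]; simp)+
  have D03: "0 \<noteq> (3::'a)"
    by (rule affine_ne[OF one_neq_zero small_numerals_ne_0(2)]; simp)
  have D11: "0 \<noteq> \<nu>" "1 \<noteq> 1 + \<nu>" "2 \<noteq> 2 + \<nu>" "\<nu> \<noteq> 2 * \<nu>"
    "1 + \<nu> \<noteq> 1 + 2 * \<nu>" "2 * \<nu> \<noteq> 3 * \<nu>"
    by (rule affine_ne[OF ne(1) one_neq_zero]; simp add: algebra_simps)+
  have D12: "0 \<noteq> 2 * \<nu>" "1 \<noteq> 1 + 2 * \<nu>" "\<nu> \<noteq> 3 * \<nu>"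
    by (rule affine_ne[OF ne(1) small_numerals_ne_0(1)]; simp add: algebra_simps)+
  have D13: "0 \<noteq> 3 * \<nu>"
    by (rule affine_ne[OF ne(1) small_numerals_ne_0(2)]; simp add: algebra_simps)+
  have D21: "1 \<noteq> \<nu>" "2 \<noteq> 1 + \<nu>" "3 \<noteq> 2 + \<nu>"
    "1 + \<nu> \<noteq> 2 * \<nu>" "2 + \<nu> \<noteq> 1 + 2 * \<nu>"
    "1 + 2 * \<nu> \<noteq> 3 * \<nu>"
    by (rule affine_ne[OF ne(2) one_neq_zero]; simp add: algebra_simps)+
  have D22: "2 \<noteq> 2 * \<nu>" "3 \<noteq> 1 + 2 * \<nu>" "2 + \<nu> \<noteq> 3 * \<nu>"
    by (rule affine_ne[OF ne(2) small_numerals_ne_0(1)]; simp add: algebra_simps)+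
  have D23: "3 \<noteq> 3 * \<nu>"
    by (rule affine_ne[OF ne(2) small_numerals_ne_0(2)]; simp add: algebra_simps)+
  have D31: "2 \<noteq> \<nu>" "3 \<noteq> 1 + \<nu>" "2 + \<nu> \<noteq> 2 * \<nu>"
    by (rule affine_ne[OF ne(3) one_neq_zero]; simp add: algebra_simps)+
  have D41: "3 \<noteq> \<nu>"
    by (rule affine_ne[OF ne(4) one_neq_zero]; simp add: algebra_simps)+
  have D51: "0 \<noteq> 1 + \<nu>" "1 \<noteq> 2 + \<nu>" "\<nu> \<noteq> 1 + 2 * \<nu>"
    by (rule affine_ne[OF ne(5) one_neq_zero]; simp add: algebra_simps)+
  have D61: "1 \<noteq> 2 * \<nu>" "2 \<noteq> 1 + 2 * \<nu>" "1 + \<nu> \<noteq> 3 * \<nu>"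
    by (rule affine_ne[OF ne(6) one_neq_zero]; simp add: algebra_simps)+
  have D71: "1 \<noteq> 3 * \<nu>"
    by (rule affine_ne[OF ne(7) one_neq_zero]; simp add: algebra_simps)+
  have D81: "0 \<noteq> 2 + \<nu>"
    by (rule affine_ne[OF ne(8) one_neq_zero]; simp add: algebra_simps)+
  have D91: "3 \<noteq> 2 * \<nu>"
    by (rule affine_ne[OF ne(9) one_neq_zero]; simp add: algebra_simps)+
  have D101: "0 \<noteq> 1 + 2 * \<nu>"
    by (rule affine_ne[OF ne(10) one_neq_zero]; simp add: algebra_simps)+
  have D111: "2 \<noteq> 3 * \<nu>"
    by (rule affine_ne[OF ne(11) one_neq_zero]; simp add: algebra_simps)+
  have "distinct ?L"
    using D01 D02 D03 D11 D12 D13 D21 D22 D23 D31 D41 D51 D61 D71 D81 D91 D101 D111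
    by simp
  hence "card (set ?L) = 10" by (subst distinct_card) simp_all
  moreover have "card (set ?L) < 10"
    by (rule card_exponents) (use exponents_basic in auto)
  ultimately show ?thesis by simp
qed

end

section \<open>Existence of the order sequence\<close>

lemma comm_ring_hom_fps_of_poly: "comm_ring_hom (fps_of_poly :: 'a::comm_ring_1 poly \<Rightarrow> 'a fps)"
  by unfold_locales (simp_all add: fps_of_poly_add fps_of_poly_mult)

lemma comm_ring_hom_poly_at: "comm_ring_hom (\<lambda>P :: 'a::comm_ring_1 poly. poly P r)"
  by unfold_locales simp_all

text \<open>Multiplication by the powers of \<open>Y\<close> turns a relation into a square system whose matrix
  is triangular at \<open>r\<close>, because \<open>h\<close> vanishes there.\<close>

lemma radical_relation_constant_coeff:
  fixes h :: "'a::field poly" and Y :: "'a fps"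
  assumes Y: "Y ^ n = fps_of_poly h" and h: "poly h r = 0" and n: "n > 0"
    and rel: "(\<Sum>j<n. fps_of_poly (g j) * Y ^ j) = 0"
  shows "poly (g 0) r = 0"
proof -
  define M where "M i j = (if i \<le> j then g (j - i) else h * g (n + j - i))" for i j
  have "(\<Sum>j<n. fps_of_poly (M i j) * Y ^ j) = 0" if i: "i < n" for i
  proof -
    have "0 = Y ^ i * (\<Sum>l<n. fps_of_poly (g l) * Y ^ l)" using rel by simp
    also have "\<dots> = (\<Sum>l<n. fps_of_poly (g l) * Y ^ (l + i))"
      by (simp add: sum_distrib_left power_add mult_ac)
    also have "\<dots> = (\<Sum>l<n-i. fps_of_poly (g l) * Y ^ (l + i)) + (\<Sum>l\<in>{n-i..<n}. fps_of_poly (g l) * Y ^ (l + i))"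
      by (subst sum.union_disjoint[symmetric]) (auto intro!: sum.cong)
    also have "(\<Sum>l<n-i. fps_of_poly (g l) * Y ^ (l + i)) = (\<Sum>j\<in>{i..<n}. fps_of_poly (M i j) * Y ^ j)"
      by (rule sum.reindex_bij_witness[of _ "\<lambda>j. j - i" "\<lambda>l. l + i"]) (use i in \<open>auto simp: M_def\<close>)
    also have "(\<Sum>l\<in>{n-i..<n}. fps_of_poly (g l) * Y ^ (l + i)) = (\<Sum>j<i. fps_of_poly (M i j) * Y ^ j)"
    proof (rule sum.reindex_bij_witness[of _ "\<lambda>j. n + j - i" "\<lambda>l. l + i - n"])
      fix l assume l: "l \<in> {n-i..<n}"
      hence "n \<le> l + i" by auto
      hence "Y ^ (l + i) = Y ^ n * Y ^ (l + i - n)" by (simp flip: power_add)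
      thus "fps_of_poly (M i (l + i - n)) * Y ^ (l + i - n) = fps_of_poly (g l) * Y ^ (l + i)"
        using l i by (auto simp: M_def Y fps_of_poly_mult mult_ac)
    qed (use i in auto)
    also have "(\<Sum>j\<in>{i..<n}. fps_of_poly (M i j) * Y ^ j) + (\<Sum>j<i. fps_of_poly (M i j) * Y ^ j) =
        (\<Sum>j<n. fps_of_poly (M i j) * Y ^ j)"
      using i by (subst sum.union_disjoint[symmetric]) (auto intro!: sum.cong)
    finally show ?thesis by simp
  qed
  hence "det (mat n n (\<lambda>(i, j). fps_of_poly (M i j))) = 0"
    using n by (intro det_eq_0I[of _ "\<lambda>j. Y ^ j"]) (auto intro: exI[of _ 0])
  moreover have "mat n n (\<lambda>(i, j). fps_of_poly (M i j)) = map_mat fps_of_poly (mat n n (\<lambda>(i, j). M i j))"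
    by (intro eq_matI) auto
  ultimately have "fps_of_poly (det (mat n n (\<lambda>(i, j). M i j))) = 0"
    by (simp add: comm_ring_hom.hom_det[OF comm_ring_hom_fps_of_poly])
  hence det: "det (mat n n (\<lambda>(i, j). M i j)) = 0" by simp
  \<comment> \<open>At \<open>r\<close> every diagonal entry is the value of \<open>g 0\<close>, so
    the vanishing determinant is the n-th power of that value.\<close>
  let ?N = "map_mat (\<lambda>P. poly P r) (mat n n (\<lambda>(i, j). M i j))"
  have "det ?N = 0"
    using det by (simp add: comm_ring_hom.hom_det[OF comm_ring_hom_poly_at])
  moreover have "det ?N = prod_list (diag_mat ?N)"
    by (rule det_upper_triangular[of _ n]) (auto simp: M_def h)
  moreover have "diag_mat ?N = map (\<lambda>i. poly (g 0) r) [0..<n]"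
    by (auto simp: diag_mat_def M_def)
  ultimately show ?thesis by (simp add: map_replicate_const)
qed

text \<open>Once the coefficients below m are divisible by X - r, multiplying the relation by
  \<open>Y ^ (n - m)\<close> and replacing \<open>Y ^ n\<close> by \<open>h\<close> makes all of it
  divisible by X - r. After division the constant coefficient is \<open>h' * g m\<close>, and h'
  does not vanish at r because the zero is simple.\<close>

lemma radical_relation_coeffs:
  fixes h :: "'a::field poly" and Y :: "'a fps"
  assumes Y: "Y ^ n = fps_of_poly h" and h: "h = [:- r, 1:] * h'" "poly h' r \<noteq> 0"
    and rel: "(\<Sum>j<n. fps_of_poly (g j) * Y ^ j) = 0" and "l < n"
  shows "poly (g l) r = 0"
  using \<open>l < n\<close>
proof (induction l rule: less_induct)
  case (less m)
  have "\<exists>g'. \<forall>l<m. g l = [:- r, 1:] * g' l"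
  proof -
    have "\<exists>q. g l = [:- r, 1:] * q" if "l < m" for l
      using less that by (metis dvdE order.strict_trans poly_eq_0_iff_dvd)
    thus ?thesis by metis
  qed
  then obtain g' where g': "\<And>l. l < m \<Longrightarrow> g l = [:- r, 1:] * g' l" by blast
  \<comment> \<open>The coefficients of the relation after multiplication by
    \<open>Y ^ (n - m)\<close> and division by X - r: terms that reach degree n wrap around to the
    front.\<close>
  define G where "G j = (if j < n - m then h' * g (j + m) else g' (j - (n - m)))" for j
  have "fps_of_poly [:- r, 1:] * (\<Sum>j<n. fps_of_poly (G j) * Y ^ j) = Y ^ (n - m) * (\<Sum>l<n. fps_of_poly (g l) * Y ^ l)"
  proof -
    have "fps_of_poly [:- r, 1:] * (\<Sum>j<n. fps_of_poly (G j) * Y ^ j) =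
        (\<Sum>j<n-m. fps_of_poly ([:- r, 1:] * G j) * Y ^ j)
        + (\<Sum>j\<in>{n-m..<n}. fps_of_poly ([:- r, 1:] * G j) * Y ^ j)"
      unfolding sum_distrib_left
      by (subst sum.union_disjoint[symmetric])
         (auto intro!: sum.cong simp: fps_of_poly_mult mult_ac simp del: mult_pCons_left mult_pCons_right)
    also have "(\<Sum>j<n-m. fps_of_poly ([:- r, 1:] * G j) * Y ^ j) =
        (\<Sum>l\<in>{m..<n}. Y ^ (n - m) * (fps_of_poly (g l) * Y ^ l))"
    proof (rule sum.reindex_bij_witness[of _ "\<lambda>l. l - m" "\<lambda>j. j + m"])
      fix j assume j: "j \<in> {..<n-m}"
      have "Y ^ (n - m) * Y ^ (j + m) = Y ^ n * Y ^ j"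
        using less.prems by (simp flip: power_add)
      hence "Y ^ (n - m) * (fps_of_poly (g (j + m)) * Y ^ (j + m)) = fps_of_poly (h * g (j + m)) * Y ^ j"
        by (simp add: Y fps_of_poly_mult mult_ac)
      also have "h * g (j + m) = [:- r, 1:] * G j"
        using j by (simp add: G_def h(1) mult.assoc del: mult_pCons_left mult_pCons_right)
      finally show "Y ^ (n - m) * (fps_of_poly (g (j + m)) * Y ^ (j + m)) = fps_of_poly ([:- r, 1:] * G j) * Y ^ j" .
    qed auto
    also have "(\<Sum>j\<in>{n-m..<n}. fps_of_poly ([:- r, 1:] * G j) * Y ^ j) =
        (\<Sum>l<m. Y ^ (n - m) * (fps_of_poly (g l) * Y ^ l))"
    proof (rule sum.reindex_bij_witness[of _ "\<lambda>l. l + (n - m)" "\<lambda>j. j - (n - m)"])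
      fix j assume j: "j \<in> {n-m..<n}"
      hence "j - (n - m) < m" "\<not> j < n - m" using less.prems by auto
      hence "[:- r, 1:] * G j = g (j - (n - m))"
        by (simp only: G_def g' if_False)
      moreover have "Y ^ (n - m) * Y ^ (j - (n - m)) = Y ^ j" using j by (simp flip: power_add)
      ultimately show "Y ^ (n - m) * (fps_of_poly (g (j - (n - m))) * Y ^ (j - (n - m)))
          = fps_of_poly ([:- r, 1:] * G j) * Y ^ j"
        by (simp add: mult_ac del: mult_pCons_left mult_pCons_right)
    qed (use less.prems in auto)
    also have "(\<Sum>l\<in>{m..<n}. Y ^ (n - m) * (fps_of_poly (g l) * Y ^ l)) + (\<Sum>l<m. Y ^ (n - m) * (fps_of_poly (g l) * Y ^ l))
        = Y ^ (n - m) * (\<Sum>l<n. fps_of_poly (g l) * Y ^ l)"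
      unfolding sum_distrib_left using less.prems
      by (subst sum.union_disjoint[symmetric]) (auto intro!: sum.cong)
    finally show ?thesis .
  qed
  moreover have "fps_of_poly [:- r, 1:] \<noteq> 0" using fps_of_poly_eq_iff[of "[:- r, 1:]" 0] by simp
  ultimately have "(\<Sum>j<n. fps_of_poly (G j) * Y ^ j) = 0" using rel by simp
  from radical_relation_constant_coeff[OF Y _ _ this] have "poly (G 0) r = 0"
    using less.prems h(1) by simp
  thus "poly (g m) r = 0" using less.prems h(2) by (simp add: G_def)
qed

text \<open>Descent on degrees: all coefficients are divisible by X - r, and the quotients satisfy
  the same kind of relation with smaller degrees.\<close>

lemma radical_relation_trivial:
  fixes h :: "'a::field poly" and Y :: "'a fps"
  assumes Y: "Y ^ n = fps_of_poly h" and h: "h = [:- r, 1:] * h'" "poly h' r \<noteq> 0"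
    and rel: "(\<Sum>j<n. fps_of_poly (g j) * Y ^ j) = 0" and "l < n"
  shows "g l = 0"
proof -
  have "\<forall>l<n. g l = 0" if "\<forall>l<n. g l = 0 \<or> degree (g l) < N" "(\<Sum>j<n. fps_of_poly (g j) * Y ^ j) = 0" for N g
    using that
  proof (induction N arbitrary: g)
    case (Suc N)
    have "\<exists>g'. \<forall>l<n. g l = [:- r, 1:] * g' l"
    proof -
      have "\<exists>q. g l = [:- r, 1:] * q" if "l < n" for l
        using radical_relation_coeffs[OF Y h Suc.prems(2) that] by (metis dvdE poly_eq_0_iff_dvd)
      thus ?thesis by metis
    qed
    then obtain g' where g': "\<And>l. l < n \<Longrightarrow> g l = [:- r, 1:] * g' l" by blast
    have "fps_of_poly [:- r, 1:] * (\<Sum>j<n. fps_of_poly (g' j) * Y ^ j) = (\<Sum>j<n. fps_of_poly (g j) * Y ^ j)"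
      unfolding sum_distrib_left
      by (intro sum.cong refl) (simp add: g' fps_of_poly_mult mult_ac del: mult_pCons_left mult_pCons_right)
    moreover have "fps_of_poly [:- r, 1:] \<noteq> 0" using fps_of_poly_eq_iff[of "[:- r, 1:]" 0] by simp
    ultimately have rel': "(\<Sum>j<n. fps_of_poly (g' j) * Y ^ j) = 0" using Suc.prems(2) by simp
    have "g' l = 0 \<or> degree (g' l) < N" if "l < n" for l
    proof (cases "g' l = 0")
      case False
      hence "degree (g l) = Suc (degree (g' l))" "g l \<noteq> 0"
        using g'[OF that] by (simp_all add: degree_mult_eq del: mult_pCons_left mult_pCons_right)
      thus ?thesis using Suc.prems(1) that by auto
    qed simp
    with Suc.IH[OF _ rel'] have "\<forall>l<n. g' l = 0" by blast
    thus ?case using g' by simp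
  qed auto
  moreover have "\<forall>l<n. g l = 0 \<or> degree (g l) < Suc (\<Sum>l<n. degree (g l))"
    by (auto simp: less_Suc_eq_le intro: member_le_sum)
  ultimately show ?thesis using rel \<open>l < n\<close> by blast
qed

lemma mono_exp_inj: "c < 10 \<Longrightarrow> d < 10 \<Longrightarrow> mono_exp c = mono_exp d \<Longrightarrow> c = d"
proof -
  have "distinct cubic_monos" "length cubic_monos = 10" by (simp_all add: cubic_monos_def)
  thus "c < 10 \<Longrightarrow> d < 10 \<Longrightarrow> mono_exp c = mono_exp d \<Longrightarrow> c = d"
    unfolding mono_exp_def by (simp add: nth_eq_iff_index_eq)
qed

lemma snd_mono_exp: "c < 10 \<Longrightarrow> snd (mono_exp c) \<le> 3"
proof -
  have "\<forall>m\<in>set cubic_monos. snd m \<le> 3" "length cubic_monos = 10" by (simp_all add: cubic_monos_def)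
  thus "c < 10 \<Longrightarrow> snd (mono_exp c) \<le> 3" unfolding mono_exp_def by simp
qed

lemma pcompose_monom: "monom a k \<circ>\<^sub>p q = smult a (q ^ k)" for q :: "'a::comm_ring_1 poly"
  by (induction k) (simp_all add: monom_0 monom_Suc pcompose_pCons)

text \<open>Collected by powers of \<open>Y\<close>, a linear relation is a polynomial relation of
  degree at most 3 in \<open>Y\<close>. This is less than n, and \<open>Y ^ n\<close> has a simple
  zero where X = 1.\<close>

lemma cubic_monos_independent:
  fixes x y :: "'a::field"
  assumes n: "of_nat n \<noteq> (0::'a)" "n > 3" and Y: "(fps_const x + fps_X) ^ n + Y ^ n = 1"
    and rel: "(\<Sum>c<10. fps_const (v c) * ((fps_const x + fps_X) ^ fst (mono_exp c) * Y ^ snd (mono_exp c))) = 0"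
    and "c < 10"
  shows "v c = 0"
proof -
  define X where "X = [:x, 1:]"
  have X: "fps_of_poly X = fps_const x + fps_X"
    by (simp add: X_def fps_of_poly_pCons)
  define h where "h = 1 - X ^ n"
  have Yn: "Y ^ n = fps_of_poly h"
    using Y by (simp add: h_def fps_of_poly_diff fps_of_poly_power X algebra_simps)
  \<comment> \<open>The variable here is the increment T with X = x + T, so X = 1 means T = 1 -
    x.\<close>
  have Xr: "poly X (1 - x) = 1" by (simp add: X_def)
  have "poly h (1 - x) = 0" by (simp add: h_def Xr)
  then obtain h' where h': "h = [:- (1 - x), 1:] * h'" by (metis dvdE poly_eq_0_iff_dvd)
  have "poly h' (1 - x) \<noteq> 0"
  proof -
    have "poly (pderiv h) (1 - x) = - of_nat n"
      by (simp add: h_def pderiv_diff pderiv_power Xr) (simp add: X_def pderiv_pCons)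
    moreover have "poly (pderiv h) (1 - x) = poly h' (1 - x)"
      unfolding h' pderiv_mult by (simp add: pderiv_pCons algebra_simps)
    ultimately show ?thesis using n by simp
  qed
  note trivial = radical_relation_trivial[OF Yn h' this]
  define C where "C j = {c. c < 10 \<and> snd (mono_exp c) = j}" for j
  have fin: "finite (C j)" for j by (simp add: C_def)
  define w where "w j = (\<Sum>c\<in>C j. monom (v c) (fst (mono_exp c)))" for j
  have "fps_of_poly (w j \<circ>\<^sub>p X) * Y ^ j = (\<Sum>c\<in>C j. fps_const (v c) *
      ((fps_const x + fps_X) ^ fst (mono_exp c) * Y ^ snd (mono_exp c)))" for j
  proof -
    have "w j \<circ>\<^sub>p X = (\<Sum>c\<in>C j. smult (v c) (X ^ fst (mono_exp c)))"
      by (simp add: w_def pcompose_sum pcompose_monom)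
    hence "fps_of_poly (w j \<circ>\<^sub>p X) = (\<Sum>c\<in>C j. fps_const (v c) * (fps_const x + fps_X) ^ fst (mono_exp c))"
      by (simp add: fps_of_poly_sum fps_of_poly_smult fps_of_poly_power X)
    thus ?thesis by (simp add: sum_distrib_right C_def mult.assoc)
  qed
  hence "(\<Sum>j<n. fps_of_poly (w j \<circ>\<^sub>p X) * Y ^ j) = (\<Sum>j<n. \<Sum>c\<in>C j. fps_const (v c) *
      ((fps_const x + fps_X) ^ fst (mono_exp c) * Y ^ snd (mono_exp c)))" by simp
  also have "\<dots> = (\<Sum>c\<in>(\<Union>j<n. C j). fps_const (v c) *
      ((fps_const x + fps_X) ^ fst (mono_exp c) * Y ^ snd (mono_exp c)))"
    by (rule sum.UNION_disjoint[symmetric]) (auto simp: fin, auto simp: C_def)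
  also have "(\<Union>j<n. C j) = {..<10}"
    using n(2) snd_mono_exp by (fastforce simp: C_def)
  finally have "(\<Sum>j<n. fps_of_poly (w j \<circ>\<^sub>p X) * Y ^ j) = 0" using rel by simp
  from trivial[OF this, of "snd (mono_exp c)"] have "w (snd (mono_exp c)) \<circ>\<^sub>p X = 0"
    using snd_mono_exp[OF \<open>c < 10\<close>] n(2) by simp
  hence "w (snd (mono_exp c)) = 0"
    by (rule pcompose_eq_0) (simp add: X_def)
  hence "0 = coeff (w (snd (mono_exp c))) (fst (mono_exp c))" by simp
  also have "\<dots> = (\<Sum>d\<in>C (snd (mono_exp c)). if d = c then v d else 0)"
    unfolding w_def coeff_sum
    by (intro sum.cong refl) (auto simp: C_def dest: mono_exp_inj[OF _ \<open>c < 10\<close>] intro: prod_eqI)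
  also have "\<dots> = v c" using fin \<open>c < 10\<close> by (simp add: C_def)
  finally show ?thesis by simp
qed

text \<open>Independent columns of a matrix with infinitely many rows have a nonsingular square
  minor. In the induction a minor is extended by a variable row: were all the extended determinants
  zero, the cofactors along that row would be a nontrivial dependency of the columns.\<close>

lemma exists_nonsingular_rows:
  fixes f :: "nat \<Rightarrow> nat \<Rightarrow> 'a::field"
  assumes "\<And>v. (\<And>k. (\<Sum>c<m. f k c * v c) = 0) \<Longrightarrow> \<forall>c<m. v c = 0"
  shows "\<exists>r. det (mat m m (\<lambda>(i, c). f (r i) c)) \<noteq> 0"
  using assms
proof (induction m)
  case 0
  thus ?case by (simp add: det_dim_zero)
next
  case (Suc m)
  have "\<exists>r. det (mat m m (\<lambda>(i, c). f (r i) c)) \<noteq> 0"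
  proof (rule Suc.IH)
    fix v assume v: "\<And>k. (\<Sum>c<m. f k c * v c) = 0"
    have "\<forall>c<Suc m. (if c < m then v c else 0) = 0"
      by (rule Suc.prems) (simp add: v)
    thus "\<forall>c<m. v c = 0" by (metis less_Suc_eq)
  qed
  then obtain r where r: "det (mat m m (\<lambda>(i, c). f (r i) c)) \<noteq> 0" by blast
  define A where "A k = mat (Suc m) (Suc m) (\<lambda>(i, c). f ((r(m := k)) i) c)" for k
  have del: "mat_delete (A k) m c = mat_delete (A 0) m c" for k c
    by (intro eq_matI) (auto simp: mat_delete_def A_def)
  have "mat_delete (A 0) m m = mat m m (\<lambda>(i, c). f (r i) c)"
    by (intro eq_matI) (auto simp: mat_delete_def A_def)
  hence nz: "cofactor (A 0) m m \<noteq> 0" using r by (simp add: cofactor_def)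
  have expand: "det (A k) = (\<Sum>c<Suc m. f k c * cofactor (A 0) m c)" for k
  proof -
    have "det (A k) = (\<Sum>c<Suc m. A k $$ (m, c) * cofactor (A k) m c)"
      by (rule laplace_expansion_row) (auto simp: A_def)
    also have "\<dots> = (\<Sum>c<Suc m. f k c * cofactor (A 0) m c)"
      by (intro sum.cong refl) (simp add: cofactor_def del[of k], simp add: A_def)
    finally show ?thesis .
  qed
  have "\<exists>k. det (A k) \<noteq> 0"
  proof (rule ccontr)
    assume "\<not> ?thesis"
    hence "\<forall>c<Suc m. cofactor (A 0) m c = 0" by (intro Suc.prems) (unfold expand[symmetric], blast)
    thus False using nz by blast
  qed
  thus ?case unfolding A_def by blast
qed

text \<open>The right-hand side sees only the set of orders, so rows may be rearranged.\<close>

lemma cubic_wronskian_eq_0_iff: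
  assumes "length eps = 10"
  shows "cubic_wronskian n x y eps = 0 \<longleftrightarrow>
    (\<exists>v. (\<exists>c<10. v c \<noteq> 0) \<and> (\<forall>k\<in>set eps. (\<Sum>c<10. hasse_mono n x y k (mono_exp c) * v c) = 0))"
proof -
  have eq: "mat 10 10 (\<lambda>(k, c). hasse_mono n x y (eps ! k) (cubic_monos ! c))
      = mat 10 10 (\<lambda>(k, c). hasse_mono n x y (eps ! k) (mono_exp c))"
    by (simp add: mono_exp_def)
  have set: "(\<forall>k\<in>set eps. P k) \<longleftrightarrow> (\<forall>i<10. P (eps ! i))" for P
    using assms by (simp add: all_set_conv_all_nth)
  show ?thesis
    unfolding cubic_wronskian_def eq set
    by (rule iffI, erule det_eq_0_kernel, blast, blast intro: det_eq_0I)
qed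

lemma admissible_seq_exists:
  fixes x y :: "'a::field"
  assumes n: "of_nat n \<noteq> (0::'a)" "n > 3" and y: "y \<noteq> 0" "x ^ n + y ^ n = 1"
  shows "\<exists>eps. admissible_seq n x y eps"
proof -
  let ?f = "\<lambda>k c. hasse_mono n x y k (mono_exp c)"
  have "\<exists>r. det (mat 10 10 (\<lambda>(i, c). ?f (r i) c)) \<noteq> 0"
  proof (rule exists_nonsingular_rows, intro allI impI)
    fix v :: "nat \<Rightarrow> 'a" and c :: nat
    assume v: "\<And>k. (\<Sum>c<10. ?f k c * v c) = 0" and "c < 10"
    show "v c = 0"
    proof (rule cubic_monos_independent[OF n fermat_taylor_y(2)[OF n(1) y]])
      show "(\<Sum>c<10. fps_const (v c) * ((fps_const x + fps_X) ^ fst (mono_exp c)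
          * fermat_taylor_y n x y ^ snd (mono_exp c))) = 0"
        using v by (intro fps_ext) (simp add: fps_sum_nth hasse_mono_def mult.commute)
    qed fact
  qed
  then obtain r where r: "det (mat 10 10 (\<lambda>(i, c). ?f (r i) c)) \<noteq> 0" by blast
  have inj: "inj_on r {..<10}"
  proof (rule inj_onI, rule ccontr)
    fix i j assume ij: "i \<in> {..<10}" "j \<in> {..<10}" "r i = r j" "i \<noteq> j"
    have "det (mat 10 10 (\<lambda>(i, c). ?f (r i) c)) = 0"
      by (rule det_identical_rows[of _ 10 i j]) (use ij in \<open>auto intro!: eq_vecI\<close>)
    thus False using r by blast
  qed
  \<comment> \<open>The chosen rows are distinct, so sorting them yields a strictly increasing
    sequence of length 10.\<close>
  define eps where "eps = sorted_list_of_set (r ` {..<10})"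
  have set: "set eps = r ` {..<10}" by (simp add: eps_def)
  have len: "length eps = 10" by (simp add: eps_def card_image[OF inj])
  have "cubic_wronskian n x y eps \<noteq> 0"
  proof
    assume "cubic_wronskian n x y eps = 0"
    then obtain v where v: "\<exists>c<10. v c \<noteq> 0" "\<forall>k\<in>set eps. (\<Sum>c<10. ?f k c * v c) = 0"
      unfolding cubic_wronskian_eq_0_iff[OF len] by blast
    have "det (mat 10 10 (\<lambda>(i, c). ?f (r i) c)) = 0"
      by (rule det_eq_0I[OF v(1)]) (use v(2) set in auto)
    thus False using r by blast
  qed
  thus ?thesis using len by (intro exI[of _ eps]) (simp add: admissible_seq_def eps_def)
qed

section \<open>The lexicographic minimum and the criterion for classicality\<close>

definition lex_less :: "nat list \<Rightarrow> nat list \<Rightarrow> bool" where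
  "lex_less a b \<longleftrightarrow> (\<exists>k<10. take k a = take k b \<and> a ! k < b ! k)"

lemma lex_less_total:
  assumes "length a = 10" "length b = 10" "a \<noteq> b"
  shows "lex_less a b \<or> lex_less b a"
proof -
  let ?P = "\<lambda>k. k < 10 \<and> a ! k \<noteq> b ! k"
  define k where "k = (LEAST k. ?P k)"
  have "\<exists>k. ?P k" using assms by (metis nth_equalityI)
  hence k: "?P k" unfolding k_def by (rule LeastI_ex)
  have "a ! i = b ! i" if "i < k" for i
    using not_less_Least[of i ?P] that k unfolding k_def by auto
  hence "take k a = take k b" using assms k by (intro nth_equalityI) auto
  thus ?thesis using k unfolding lex_less_def by (metis linorder_neq_iff)
qed

lemma lex_less_asym:
  assumes "lex_less a b" "lex_less b a"
  shows False
proof -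
  from assms obtain k l where kl: "take k a = take k b" "a ! k < b ! k" "take l b = take l a" "b ! l < a ! l"
    unfolding lex_less_def by blast
  consider "k < l" | "l < k" | "k = l" by linarith
  thus False
  proof cases
    case 1
    hence "a ! k = b ! k" using kl(3) by (metis nth_take)
    thus ?thesis using kl(2) by simp
  next
    case 2
    hence "a ! l = b ! l" using kl(1) by (metis nth_take)
    thus ?thesis using kl(4) by simp
  qed (use kl in simp)
qed

lemma lex_less_imp_lexn:
  assumes "length a = 10" "length b = 10" "lex_less a b"
  shows "(a, b) \<in> lexn less_than 10"
proof -
  from assms obtain k where k: "k < 10" "take k a = take k b" "a ! k < b ! k"
    unfolding lex_less_def by blast
  have "a = take k b @ a ! k # drop (Suc k) a" "b = take k b @ b ! k # drop (Suc k) b"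
    using assms id_take_nth_drop[of k a] id_take_nth_drop[of k b] k(1,2) by simp_all
  thus ?thesis unfolding lexn_conv using assms k(3) by auto
qed

lemma order_sequence_cubics_eqI:
  assumes "admissible_seq n x y eps"
    and "\<And>eps'. admissible_seq n x y eps' \<Longrightarrow> eps = eps' \<or> lex_less eps eps'"
  shows "order_sequence_cubics n x y = eps"
  unfolding order_sequence_cubics_def lex_less_def[symmetric]
  by (rule the_equality) (use assms lex_less_asym in blast)+

text \<open>Well-foundedness of the lexicographic order on lists of fixed length gives a minimal
  admissible sequence, and totality makes it the least one.\<close>

lemma admissible_order_sequence_cubics:
  assumes "\<exists>eps. admissible_seq n x y eps"
  shows "admissible_seq n x y (order_sequence_cubics n x y)"
proof -
  let ?A = "{eps. admissible_seq n x y eps}"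
  have "wf (lexn less_than 10)" by (rule wf_lexn) simp
  then obtain eps where eps: "eps \<in> ?A" "\<And>b. (b, eps) \<in> lexn less_than 10 \<Longrightarrow> b \<notin> ?A"
    using assms wfE_min'[of "lexn less_than 10" ?A] by (metis mem_Collect_eq empty_iff)
  have "eps = b \<or> lex_less eps b" if "admissible_seq n x y b" for b
  proof -
    have len: "length eps = 10" "length b = 10" using eps(1) that by (simp_all add: admissible_seq_def)
    have "\<not> lex_less b eps" using lex_less_imp_lexn[OF len(2,1)] eps(2)[of b] that by blast
    thus ?thesis using lex_less_total[OF len] by blast
  qed
  with eps(1) have "order_sequence_cubics n x y = eps" by (intro order_sequence_cubics_eqI) auto
  thus ?thesis using eps(1) by simp
qed

text \<open>A strictly increasing sequence of naturals satisfies \<open>k \<le> eps ! k\<close>, so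
  \<open>[0..<10]\<close> is the least possible one. Conversely, existence of an admissible sequence
  ensures that the order sequence is itself admissible.\<close>

lemma classical_cubics_iff:
  fixes x y :: "'a::field"
  assumes n: "of_nat n \<noteq> (0::'a)" "n > 3" and y: "y \<noteq> 0" "x ^ n + y ^ n = 1"
  shows "classical_cubics n x y \<longleftrightarrow> cubic_wronskian n x y [0..<10] \<noteq> 0"
proof
  assume "classical_cubics n x y"
  thus "cubic_wronskian n x y [0..<10] \<noteq> 0"
    using admissible_order_sequence_cubics[OF admissible_seq_exists[OF assms]]
    by (simp add: classical_cubics_def admissible_seq_def)
next
  assume w: "cubic_wronskian n x y [0..<10] \<noteq> 0"
  have "order_sequence_cubics n x y = [0..<10]"
  proof (rule order_sequence_cubics_eqI)
    show "admissible_seq n x y [0..<10]"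
      using w by (simp add: admissible_seq_def del: upt_rec_numeral)
    fix eps assume "admissible_seq n x y eps"
    hence len: "length eps = 10" and sorted: "sorted_wrt (<) eps" by (simp_all add: admissible_seq_def)
    have ge: "k \<le> eps ! k" if "k < 10" for k
      using that
    proof (induction k)
      case (Suc k)
      hence "eps ! k < eps ! Suc k" using sorted len by (simp add: sorted_wrt_nth_less)
      thus ?case using Suc by simp
    qed simp
    have "\<not> lex_less eps [0..<10]" unfolding lex_less_def using ge by (auto simp del: upt_rec_numeral simp: leD)
    thus "[0..<10] = eps \<or> lex_less [0..<10] eps"
      using lex_less_total[of "[0..<10]" eps] len by auto
  qed
  thus "classical_cubics n x y" by (simp add: classical_cubics_def)
qed

section \<open>Cubic relations in the exceptional cases\<close>

text \<open>Constant modulo the tenth power of the variable: such a series acts as a scalar on the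
  first ten Taylor coefficients.\<close>

definition flat :: "'a::field fps \<Rightarrow> bool" where
  "flat f \<longleftrightarrow> (\<forall>r. 0 < r \<and> r < 10 \<longrightarrow> f $ r = 0)"

lemma flat_mult_nth:
  assumes "flat f" "r < 10"
  shows "(f * g) $ r = f $ 0 * g $ r"
proof -
  have "(f * g) $ r = (\<Sum>i\<in>{0..r}. if i = 0 then f $ 0 * g $ r else 0)"
    unfolding fps_mult_nth using assms by (intro sum.cong refl) (auto simp: flat_def)
  thus ?thesis by simp
qed

lemma flat_mult: "flat f \<Longrightarrow> flat g \<Longrightarrow> flat (f * g)"
  using flat_mult_nth[of f _ g] by (auto simp: flat_def)

lemma flat_power: "flat f \<Longrightarrow> flat (f ^ k)"
  by (induction k) (auto simp: flat_mult, simp add: flat_def)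

lemma flat_uminus: "flat f \<Longrightarrow> flat (- f)"
  by (simp add: flat_def)

lemma flat_numeral: "flat (numeral k)"
  by (simp add: flat_def fps_numeral_nth)

lemma flat_0: "flat 0" and flat_1: "flat 1"
  by (simp_all add: flat_def)

text \<open>The derivative of \<open>f ^ m\<close> is zero, and its coefficients are those of
  \<open>f ^ m\<close> multiplied by indices that are invertible below 10.\<close>

lemma flat_char_power:
  fixes f :: "'a::field fps"
  assumes "of_nat m = (0::'a)" "CHAR('a) \<ge> 10"
  shows "flat (f ^ m)"
  unfolding flat_def
proof (intro allI impI)
  fix r :: nat assume r: "0 < r \<and> r < 10"
  then obtain s where s: "r = Suc s" by (cases r) auto
  have "fps_deriv (f ^ m) = 0" using assms(1) by (simp add: fps_deriv_power)
  hence "fps_deriv (f ^ m) $ s = 0" by simp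
  hence "of_nat r * (f ^ m) $ r = 0" by (simp add: s)
  moreover have "of_nat r \<noteq> (0::'a)"
    using r assms(2) by (auto simp: of_nat_eq_0_iff_char_dvd dest: dvd_imp_le)
  ultimately show "(f ^ m) $ r = 0" by simp
qed

text \<open>As flat coefficients behave like scalars up to order 9, their constant terms form a
  kernel vector of the Wronskian matrix.\<close>

lemma wronskian_eq_0_if_flat_relation:
  fixes x y :: "'a::field" and n :: nat
  defines "X \<equiv> fps_const x + fps_X" and "Y \<equiv> fermat_taylor_y n x y"
  assumes flat: "\<forall>a\<in>set [a0, a1, a2, a3, a4, a5, a6, a7, a8, a9]. flat a"
    and nz: "\<exists>a\<in>set [a0, a1, a2, a3, a4, a5, a6, a7, a8, a9]. a $ 0 \<noteq> 0"
    and rel: "a0 + a1 * X + a2 * Y + a3 * X ^ 2 + a4 * (X * Y) + a5 * Y ^ 2 + a6 * X ^ 3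
      + a7 * (X ^ 2 * Y) + a8 * (X * Y ^ 2) + a9 * Y ^ 3 = 0"
  shows "cubic_wronskian n x y [0..<10] = 0"
proof -
  define A where "A = [a0, a1, a2, a3, a4, a5, a6, a7, a8, a9]"
  have len: "length A = 10" by (simp add: A_def)
  have sum: "(\<Sum>c<10. A ! c * (X ^ fst (mono_exp c) * Y ^ snd (mono_exp c))) = 0"
    using rel by (simp add: A_def mono_exp_def cubic_monos_def eval_nat_numeral algebra_simps)
  have "(\<Sum>c<10. hasse_mono n x y k (mono_exp c) * (A ! c $ 0)) = 0" if "k < 10" for k
  proof -
    have "hasse_mono n x y k (mono_exp c) * (A ! c $ 0) =
        (A ! c * (X ^ fst (mono_exp c) * Y ^ snd (mono_exp c))) $ k" if "c < 10" for c
      using flat_mult_nth[of "A ! c" k] flat \<open>k < 10\<close> that len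
      by (simp add: hasse_mono_def X_def Y_def flip: A_def)
    hence "(\<Sum>c<10. hasse_mono n x y k (mono_exp c) * (A ! c $ 0)) =
        (\<Sum>c<10. A ! c * (X ^ fst (mono_exp c) * Y ^ snd (mono_exp c))) $ k"
      unfolding fps_sum_nth by (intro sum.cong) auto
    thus ?thesis by (simp only: sum fps_zero_nth)
  qed
  moreover have "\<exists>c<10. A ! c $ 0 \<noteq> 0"
    using nz len unfolding A_def[symmetric] by (metis in_set_conv_nth)
  ultimately show ?thesis
    by (subst cubic_wronskian_eq_0_iff) (auto intro!: exI[of _ "\<lambda>c. A ! c $ 0"] simp del: upt_rec_numeral)
qed

lemma wronskian_eq_0:
  fixes x y :: "'a::field"
  assumes n: "of_nat n \<noteq> (0::'a)" "n > 3" and xy: "y \<noteq> 0" "x ^ n + y ^ n = 1"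
    and p: "CHAR('a) \<ge> 10"
    and cases: "CHAR('a) dvd n - 1 \<or> CHAR('a) dvd n - 2 \<or> CHAR('a) dvd n - 3 \<or> CHAR('a) dvd n + 1
      \<or> CHAR('a) dvd 2 * n - 1 \<or> CHAR('a) dvd 3 * n - 1"
  shows "cubic_wronskian n x y [0..<10] = 0"
proof -
  define X where "X = fps_const x + fps_X"
  define Y where "Y = fermat_taylor_y n x y"
  have XY: "X ^ n + Y ^ n = 1"
    using fermat_taylor_y(2)[OF n(1) xy] by (simp add: X_def Y_def)
  have XY': "-1 + X ^ n + Y ^ n = 0"
    unfolding add.assoc XY by simp
  note intro = wronskian_eq_0_if_flat_relation[of _ _ _ _ _ _ _ _ _ _ x n y, folded X_def Y_def]
  have flat: "flat (f ^ m)" if "CHAR('a) dvd m" for f :: "'a fps" and m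
    using that p by (intro flat_char_power) (simp_all add: of_nat_eq_0_iff_char_dvd)
  note flats = flat flat_mult flat_power flat_uminus flat_numeral flat_0 flat_1
  from cases consider "CHAR('a) dvd n - 1" | "CHAR('a) dvd n - 2" | "CHAR('a) dvd n - 3"
    | "CHAR('a) dvd n + 1" | "CHAR('a) dvd 2 * n - 1" | "CHAR('a) dvd 3 * n - 1" by blast
  thus ?thesis
  proof cases
    case 1
    \<comment> \<open>In the first three cases \<open>X ^ n\<close> and \<open>Y ^ n\<close> are
      flat multiples of a first, second or third power, so the Fermat equation itself is the
      relation.\<close>
    define P where "P = X ^ (n - 1)"
    define Q where "Q = Y ^ (n - 1)"
    have PQ: "flat P" "flat Q" unfolding P_def Q_def by (rule flat[OF 1])+
    have eqs: "X ^ n = P * X" "Y ^ n = Q * Y"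
      using n(2) by (simp_all add: P_def Q_def flip: power_Suc2)
    have "-1 + P * X + Q * Y = 0" using XY' unfolding eqs .
    thus ?thesis
      by (intro intro[of "-1" P Q 0 0 0 0 0 0 0]) (simp_all add: flats PQ)
  next
    case 2
    define P where "P = X ^ (n - 2)"
    define Q where "Q = Y ^ (n - 2)"
    have PQ: "flat P" "flat Q" unfolding P_def Q_def by (rule flat[OF 2])+
    have "n - 2 + 2 = n" using n(2) by linarith
    hence eqs: "X ^ n = P * X ^ 2" "Y ^ n = Q * Y ^ 2"
      unfolding P_def Q_def power_add[symmetric] by (simp_all only:)
    have "-1 + P * X ^ 2 + Q * Y ^ 2 = 0" using XY' unfolding eqs .
    thus ?thesis
      by (intro intro[of "-1" 0 0 P 0 Q 0 0 0 0]) (simp_all add: flats PQ)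
  next
    case 3
    define P where "P = X ^ (n - 3)"
    define Q where "Q = Y ^ (n - 3)"
    have PQ: "flat P" "flat Q" unfolding P_def Q_def by (rule flat[OF 3])+
    have "n - 3 + 3 = n" using n(2) by linarith
    hence eqs: "X ^ n = P * X ^ 3" "Y ^ n = Q * Y ^ 3"
      unfolding P_def Q_def power_add[symmetric] by (simp_all only:)
    have "-1 + P * X ^ 3 + Q * Y ^ 3 = 0" using XY' unfolding eqs .
    thus ?thesis
      by (intro intro[of "-1" 0 0 0 0 0 P 0 0 Q]) (simp_all add: flats PQ)
  next
    case 4
    define P where "P = X ^ (n + 1)"
    define Q where "Q = Y ^ (n + 1)"
    have PQ: "flat P" "flat Q" unfolding P_def Q_def by (rule flat[OF 4])+
    \<comment> \<open>The Fermat equation multiplied by \<open>X * Y\<close>, which raises both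
      exponents to n + 1.\<close>
    have "Q * X + P * Y + -1 * (X * Y) = X * Y * (X ^ n + Y ^ n - 1)"
      by (simp add: P_def Q_def algebra_simps)
    also have "\<dots> = 0" using XY by simp
    finally show ?thesis
      by (intro intro[of 0 Q P 0 "-1" 0 0 0 0 0]) (simp_all add: flats PQ)
  next
    case 5
    define P where "P = X ^ (2 * n - 1)"
    define Q where "Q = Y ^ (2 * n - 1)"
    have PQ: "flat P" "flat Q" unfolding P_def Q_def by (rule flat[OF 5])+
    define u where "u = X ^ n"
    have v: "Y ^ n = 1 - u" using XY by (simp add: u_def algebra_simps)
    have PX: "P * X = u ^ 2"
    proof -
      have "Suc (2 * n - 1) = n * 2" using n(2) by simp
      hence "P * X = X ^ (n * 2)" unfolding P_def power_Suc2[symmetric] by (simp only:)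
      thus ?thesis by (simp add: u_def power_mult)
    qed
    have QY: "Q * Y = (1 - u) ^ 2"
    proof -
      have "Suc (2 * n - 1) = n * 2" using n(2) by simp
      hence "Q * Y = Y ^ (n * 2)" unfolding Q_def power_Suc2[symmetric] by (simp only:)
      thus ?thesis by (simp add: power_mult v)
    qed
    \<comment> \<open>With A = \<open>P * X\<close> and B = \<open>Q * Y\<close>, suitable square
      roots of A and B add up to 1; clearing the radicals gives (1 - A - B)^2 = 4 A B.\<close>
    have "1 + (-2 * P) * X + (-2 * Q) * Y + P ^ 2 * X ^ 2 + (-2 * (P * Q)) * (X * Y) + Q ^ 2 * Y ^ 2
        = (1 - P * X - Q * Y) ^ 2 - 4 * (P * X) * (Q * Y)"
      by (simp add: power2_eq_square algebra_simps)
    also have "\<dots> = 0" unfolding PX QY by (simp add: power2_eq_square algebra_simps)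
    finally show ?thesis
      by (intro intro[of 1 "-2 * P" "-2 * Q" "P ^ 2" "-2 * (P * Q)" "Q ^ 2" 0 0 0 0])
         (simp_all add: flats PQ)
  next
    case 6
    define P where "P = X ^ (3 * n - 1)"
    define Q where "Q = Y ^ (3 * n - 1)"
    have PQ: "flat P" "flat Q" unfolding P_def Q_def by (rule flat[OF 6])+
    define u where "u = X ^ n"
    have v: "Y ^ n = 1 - u" using XY by (simp add: u_def algebra_simps)
    have PX: "P * X = u ^ 3"
    proof -
      have "Suc (3 * n - 1) = n * 3" using n(2) by simp
      hence "P * X = X ^ (n * 3)" unfolding P_def power_Suc2[symmetric] by (simp only:)
      thus ?thesis by (simp add: u_def power_mult)
    qed
    have QY: "Q * Y = (1 - u) ^ 3"
    proof -
      have "Suc (3 * n - 1) = n * 3" using n(2) by simp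
      hence "Q * Y = Y ^ (n * 3)" unfolding Q_def power_Suc2[symmetric] by (simp only:)
      thus ?thesis by (simp add: power_mult v)
    qed
    \<comment> \<open>Here suitable cube roots of A = \<open>P * X\<close> and B =
      \<open>Q * Y\<close> add up to 1, whence (1 - A - B)^3 = 27 A B. The coefficient -21 is 6 -
      27.\<close>
    have "1 + (-3 * P) * X + (-3 * Q) * Y + (3 * P ^ 2) * X ^ 2 + (-21 * (P * Q)) * (X * Y)
        + (3 * Q ^ 2) * Y ^ 2 + (- (P ^ 3)) * X ^ 3 + (-3 * (P ^ 2 * Q)) * (X ^ 2 * Y)
        + (-3 * (P * Q ^ 2)) * (X * Y ^ 2) + (- (Q ^ 3)) * Y ^ 3
        = (1 - P * X - Q * Y) ^ 3 - 27 * (P * X) * (Q * Y)"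
      by (simp add: power2_eq_square power3_eq_cube algebra_simps)
    also have "\<dots> = 0"
    proof -
      have "1 - u ^ 3 - (1 - u) ^ 3 = 3 * (u * (1 - u))"
        by (simp add: power3_eq_cube algebra_simps)
      thus ?thesis unfolding PX QY by (simp add: power_mult_distrib)
    qed
    finally show ?thesis
      by (intro intro[of 1 "-3 * P" "-3 * Q" "3 * P ^ 2" "-21 * (P * Q)" "3 * Q ^ 2" "- (P ^ 3)"
            "-3 * (P ^ 2 * Q)" "-3 * (P * Q ^ 2)" "- (Q ^ 3)"])
         (simp_all add: flats PQ)
  qed
qed

section \<open>Assembly of the two directions\<close>

theorem theorem3p8:
  fixes p h n :: nat and x y :: "'a::field"
  assumes "prime p" and "p > 11" and "h \<ge> 1" and "n > 3" and "\<not> p dvd n"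
    and "CHAR('a) = p"
    and "transcendental_over_prime p x"
    and "x ^ n + y ^ n = 1"
  shows "\<not> classical_cubics n x y \<longleftrightarrow>
           p dvd (n - 2) * (n - 1) * (n + 1) * (2 * n - 1) * (n - 3) * (3 * n - 1)"
proof -
  have n: "of_nat n \<noteq> (0::'a)" using assms(5,6) by (simp add: of_nat_eq_0_iff_char_dvd)
  have p1: "\<not> int p dvd 1" using assms(2) by auto
  have x: "x \<noteq> 0"
  proof
    assume "x = 0"
    hence "poly (map_poly of_int [:0, 1:]) x = 0" by (simp add: map_poly_pCons)
    hence "int p dvd coeff [:0, 1:] 1" using assms(7) unfolding transcendental_over_prime_def by blast
    thus False using p1 by simp
  qed
  have y: "y \<noteq> 0"
  proof
    assume "y = 0"
    hence "x ^ n = 1" using assms(4,8) by (simp add: power_0_left)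
    hence "int_eval (x ^ n) [:-1, 1:] = 0" by (simp add: int_eval_pCons)
    hence "int p dvd coeff [:-1, 1:] 1"
      by (rule transcendental_power_int_eval[OF assms(7), rotated]) (use assms(4) in simp)
    thus False using p1 by simp
  qed
  have prod: "p dvd (n - 2) * (n - 1) * (n + 1) * (2 * n - 1) * (n - 3) * (3 * n - 1) \<longleftrightarrow>
      p dvd n - 1 \<or> p dvd n - 2 \<or> p dvd n - 3 \<or> p dvd n + 1 \<or> p dvd 2 * n - 1 \<or> p dvd 3 * n - 1"
    (is "_ \<longleftrightarrow> ?D") unfolding prime_dvd_mult_iff[OF assms(1)] by blast
  have "cubic_wronskian n x y [0..<10] = 0 \<longleftrightarrow> ?D"
  proof
    assume ?D
    thus "cubic_wronskian n x y [0..<10] = 0"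
      using assms by (intro wronskian_eq_0[OF n _ y]) auto
  next
    assume "cubic_wronskian n x y [0..<10] = 0"
    hence E: "int_eval (x ^ n) (det (wron_mat n)) = 0"
      by (rule fermat_wronskian_eq_0[OF n x y assms(8)])
    have "int p dvd coeff (det (wron_mat n)) i" for i
      by (rule transcendental_power_int_eval[OF assms(7) _ E]) (use assms(4) in simp)
    \<comment> \<open>The determinant vanishes modulo p as a polynomial, so the base point can be
      left and the matrix studied at u = 0.\<close>
    hence "int_eval (fps_X :: 'a fps) (det (wron_mat n)) = 0"
      by (intro int_eval_eq_0_if_dvd) (simp add: assms(6))
    then obtain a :: "nat \<Rightarrow> 'a fps" where a: "\<exists>k<10. a k $ 0 \<noteq> 0"
      "\<And>c. c < 10 \<Longrightarrow>
         (\<Sum>k<10. a k * int_eval fps_X (wron_poly n (fst (mono_exp c)) (snd (mono_exp c)) k)) = 0"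
      by (rule wron_mat_left_kernel) blast
    \<comment> \<open>The branch of y at u = 0 with value 1, as a series in u.\<close>
    obtain W :: "'a fps" where W: "W $ 0 = 1" "W ^ n = 1 - fps_X"
      using fps_root_exists[OF n, of 1 "1 - fps_X"] by auto
    interpret local_kernel_large_char n a W "of_nat n"
      by unfold_locales (use assms n W a annihilates_power[OF n W(2) a(2)] in auto)
    show ?D
    proof (rule ccontr)
      assume "\<not> ?D"
      hence ne: "of_nat (n - 1) \<noteq> (0::'a)" "of_nat (n - 2) \<noteq> (0::'a)" "of_nat (n - 3) \<noteq> (0::'a)"
        "of_nat (n + 1) \<noteq> (0::'a)" "of_nat (2 * n - 1) \<noteq> (0::'a)" "of_nat (3 * n - 1) \<noteq> (0::'a)"
        unfolding of_nat_eq_0_iff_char_dvd assms(6) by simp_all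
      have "of_nat (n - 1) = of_nat n - (1::'a)" "of_nat (n - 2) = of_nat n - (2::'a)"
        "of_nat (n - 3) = of_nat n - (3::'a)" "of_nat (n + 1) = of_nat n - (-1::'a)"
        "of_nat (2 * n - 1) = 2 * of_nat n - (1::'a)" "of_nat (3 * n - 1) = 3 * of_nat n - (1::'a)"
        using assms(4) by (simp_all add: of_nat_diff)
      hence "of_nat n \<noteq> (1::'a)" "of_nat n \<noteq> (2::'a)" "of_nat n \<noteq> (3::'a)" "of_nat n \<noteq> (-1::'a)"
        "2 * of_nat n \<noteq> (1::'a)" "3 * of_nat n \<noteq> (1::'a)"
        using ne by (simp_all only: right_minus_eq not_False_eq_True)
      thus False by (rule nu_exceptional)
    qed
  qed
  thus ?thesis using classical_cubics_iff[OF n assms(4) y assms(8)] prod by blast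
qed

end
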